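(* Let $(\mu,\mu')$ be a regular couple of characters of $\mathcal O_r^\times$ and let $\Pi_{\mu,\mu'}$ be the associated principal split representation of $GL(2,\mathcal O_r)$. For every $0\le i\le r-1$, $\alpha\in\mathcal O_r$, $\beta\in\mathcal O_r^\times$ with $\alpha^2-\epsilon\beta^2\varpi^{2i}\in\mathcal O_r^\times$, the character of $\Pi_{\mu,\mu'}$ at $C_{i,\alpha,\beta}=\begin{pmatrix}\alpha&\varpi^i\epsilon\beta\\ \varpi^i\beta&\alpha\end{pmatrix}$ is $$\mathrm{tr}(C_{i,\alpha,\beta}|_{\Pi_{\mu,\mu'}})=0.$$
   Context: $F$ is a non-archimedean local field with ring of integers $\mathcal O$, uniformizer $\varpi$, residue field of cardinality $q$ and characteristic $p\neq2$. $r\ge2$ is an even integer, $l=r/2$, $\mathcal O_r=\mathcal O/\varpi^r\mathcal O$, $G^{(r)}=GL(2,\mathcal O_r)$. $\epsilon\in\mathcal O_r^\times$ is a fixed element which is not a square. A couple $(\mu,\mu')$ of characters $\mathcal O_r^\times\to\mathbb C^\times$ is called regular if the restriction of $\mu\mu'^{-1}$ to $1+\varpi^l\mathcal O_r$ is primitive, i.e. nontrivial on $1+\varpi^{r-1}\mathcal O_r$. Let $T=\left\{\begin{pmatrix}s_1&\varpi^ly\\ \varpi^lz&s_2\end{pmatrix}: s_1,s_2\in\mathcal O_r^\times,\ y,z\in\mathcal O_r\right\}\subset G^{(r)}$. For a regular couple, $\mu\boxtimes\mu'$ is the one-dimensional representation of $T$ given by $(\mu\boxtimes\mu')\begin{pmatrix}s_1&\varpi^ly\\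 \varpi^lz&s_2\end{pmatrix}=\mu(s_1)\mu'(s_2)$, and $\Pi_{\mu,\mu'}=\mathrm{Ind}_T^{G^{(r)}}(\mu\boxtimes\mu')$. *)

theory Defs
  imports Complex_Main "HOL-Library.Function_Algebras" "HOL-Algebra.Algebra"
begin

section \<open>Non-archimedean local fields\<close>

text \<open>The value of \<open>v\<close> at zero is irrelevant: \<open>val_ge F v n x\<close> implements the convention
  \<open>v 0 = \<infinity>\<close>.\<close>

definition val_ge :: "('a, 'm) ring_scheme \<Rightarrow> ('a \<Rightarrow> int) \<Rightarrow> int \<Rightarrow> 'a \<Rightarrow> bool"
  where "val_ge F v n x \<longleftrightarrow> x = \<zero>\<^bsub>F\<^esub> \<or> n \<le> v x"

definition val_ring :: "('a, 'm) ring_scheme \<Rightarrow> ('a \<Rightarrow> int) \<Rightarrow> ('a, 'm) ring_scheme"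
  where "val_ring F v = F\<lparr>carrier := {x \<in> carrier F. val_ge F v 0 x}\<rparr>"

definition residue_field :: "('a, 'm) ring_scheme \<Rightarrow> ('a \<Rightarrow> int) \<Rightarrow> 'a set ring"
  where "residue_field F v = val_ring F v Quot {x \<in> carrier F. val_ge F v 1 x}"

text \<open>\<open>v\<close> is the normalized discrete valuation, and completeness is completeness of the
  associated metric.\<close>

locale nonarch_local_field = field F for F :: "('a, 'm) ring_scheme" (structure) +
  fixes v :: "'a \<Rightarrow> int"
  assumes v_mult: "\<lbrakk>x \<in> carrier F - {\<zero>}; y \<in> carrier F - {\<zero>}\<rbrakk> \<Longrightarrow> v (x \<otimes> y) = v x + v y"
    and v_add: "\<lbrakk>x \<in> carrier F; y \<in> carrier F; val_ge F v n x; val_ge F v n y\<rbrakk>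
      \<Longrightarrow> val_ge F v n (x \<oplus> y)"
    and v_surj: "v ` (carrier F - {\<zero>}) = UNIV"
    and complete: "\<lbrakk>\<And>k. s k \<in> carrier F;
        \<And>n. \<exists>M. \<forall>j\<ge>M. \<forall>k\<ge>M. val_ge F v n (s j \<ominus> s k)\<rbrakk>
      \<Longrightarrow> \<exists>L\<in>carrier F. \<forall>n. \<exists>M. \<forall>k\<ge>(M::nat). val_ge F v n (s k \<ominus> L)"
    and finite_residue_field: "finite (carrier (residue_field F v))"

definition uniformizer :: "('a, 'm) ring_scheme \<Rightarrow> ('a \<Rightarrow> int) \<Rightarrow> 'a \<Rightarrow> bool"
  where "uniformizer F v \<pi> \<longleftrightarrow> \<pi> \<in> carrier F - {\<zero>\<^bsub>F\<^esub>} \<and> v \<pi> = 1"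

text \<open>The order of an element of infinite order is \<open>0\<close>, as required for characteristic zero.\<close>

definition ring_char :: "('a, 'm) ring_scheme \<Rightarrow> nat"
  where "ring_char R = group.ord (add_monoid R) \<one>\<^bsub>R\<^esub>"

definition trunc_ideal :: "('a, 'm) ring_scheme \<Rightarrow> ('a \<Rightarrow> int) \<Rightarrow> 'a \<Rightarrow> nat \<Rightarrow> 'a set"
  where "trunc_ideal F v \<pi> r = PIdl\<^bsub>val_ring F v\<^esub> (\<pi> [^]\<^bsub>val_ring F v\<^esub> r)"

definition trunc_ring :: "('a, 'm) ring_scheme \<Rightarrow> ('a \<Rightarrow> int) \<Rightarrow> 'a \<Rightarrow> nat \<Rightarrow> 'a set ring"
  where "trunc_ring F v \<pi> r = val_ring F v Quot trunc_ideal F v \<pi> r"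

definition trunc_unif :: "('a, 'm) ring_scheme \<Rightarrow> ('a \<Rightarrow> int) \<Rightarrow> 'a \<Rightarrow> nat \<Rightarrow> 'a set"
  where "trunc_unif F v \<pi> r = trunc_ideal F v \<pi> r +>\<^bsub>val_ring F v\<^esub> \<pi>"

section \<open>The group GL(2) over a ring\<close>

text \<open>The tuple \<open>(a, b, c, d)\<close> is the matrix with rows \<open>(a, b)\<close> and \<open>(c, d)\<close>.\<close>

type_synonym 'a mat2 = "'a \<times> 'a \<times> 'a \<times> 'a"

definition mat2_monoid :: "('a, 'm) ring_scheme \<Rightarrow> 'a mat2 monoid"
  where "mat2_monoid R =
    \<lparr>carrier = carrier R \<times> carrier R \<times> carrier R \<times> carrier R,
     monoid.mult = (\<lambda>(a, b, c, d) (a', b', c', d').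
       (a \<otimes>\<^bsub>R\<^esub> a' \<oplus>\<^bsub>R\<^esub> b \<otimes>\<^bsub>R\<^esub> c', a \<otimes>\<^bsub>R\<^esub> b' \<oplus>\<^bsub>R\<^esub> b \<otimes>\<^bsub>R\<^esub> d',
        c \<otimes>\<^bsub>R\<^esub> a' \<oplus>\<^bsub>R\<^esub> d \<otimes>\<^bsub>R\<^esub> c', c \<otimes>\<^bsub>R\<^esub> b' \<oplus>\<^bsub>R\<^esub> d \<otimes>\<^bsub>R\<^esub> d')),
     one = (\<one>\<^bsub>R\<^esub>, \<zero>\<^bsub>R\<^esub>, \<zero>\<^bsub>R\<^esub>, \<one>\<^bsub>R\<^esub>)\<rparr>"

definition GL2 :: "('a, 'm) ring_scheme \<Rightarrow> 'a mat2 monoid"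
  where "GL2 R = units_of (mat2_monoid R)"

section \<open>Induction of one-dimensional representations\<close>

interpretation cfun: vector_space "\<lambda>(c::complex) (f::'a \<Rightarrow> complex) x. c * f x"
  by standard (auto simp: fun_eq_iff algebra_simps)

text \<open>The trace of a linear endomorphism \<open>T\<close> of a finite-dimensional space \<open>V\<close> of complex
  functions; it does not depend on the basis \<open>B\<close> of \<open>V\<close>.\<close>

definition trace_on :: "('a \<Rightarrow> complex) set \<Rightarrow> (('a \<Rightarrow> complex) \<Rightarrow> ('a \<Rightarrow> complex)) \<Rightarrow> complex"
  where "trace_on V T =
    (let B = (SOME B. cfun.independent B \<and> cfun.span B = V)
     in \<Sum>b\<in>B. cfun.representation B (T b) b)"

text \<open>Functions on \<open>carrier G\<close> are extended by zero. \<open>G\<close> acts by right translation.\<close>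

definition ind_space ::
    "('g, 'm) monoid_scheme \<Rightarrow> 'g set \<Rightarrow> ('g \<Rightarrow> complex) \<Rightarrow> ('g \<Rightarrow> complex) set"
  where "ind_space G H \<chi> =
    {f. (\<forall>x. x \<notin> carrier G \<longrightarrow> f x = 0) \<and>
        (\<forall>h\<in>H. \<forall>x\<in>carrier G. f (h \<otimes>\<^bsub>G\<^esub> x) = \<chi> h * f x)}"

definition ind_action ::
    "('g, 'm) monoid_scheme \<Rightarrow> 'g \<Rightarrow> ('g \<Rightarrow> complex) \<Rightarrow> ('g \<Rightarrow> complex)"
  where "ind_action G g f = (\<lambda>x. if x \<in> carrier G then f (x \<otimes>\<^bsub>G\<^esub> g) else 0)"

definition ind_character ::
    "('g, 'm) monoid_scheme \<Rightarrow> 'g set \<Rightarrow> ('g \<Rightarrow> complex) \<Rightarrow> 'g \<Rightarrow> complex"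
  where "ind_character G H \<chi> g = trace_on (ind_space G H \<chi>) (ind_action G g)"

section \<open>Principal split representations\<close>

text \<open>Below, \<open>R\<close> stands for the ring of integers modulo the \<open>r\<close>-th power of the uniformizer, and
  \<open>w\<close> for the image of the uniformizer in \<open>R\<close>.\<close>

definition complex_units :: "complex monoid"
  where "complex_units = \<lparr>carrier = - {0}, monoid.mult = (*), one = 1\<rparr>"

definition congruence_units :: "('a, 'm) ring_scheme \<Rightarrow> 'a \<Rightarrow> nat \<Rightarrow> 'a set"
  where "congruence_units R w k = {\<one>\<^bsub>R\<^esub> \<oplus>\<^bsub>R\<^esub> w [^]\<^bsub>R\<^esub> k \<otimes>\<^bsub>R\<^esub> x |x. x \<in> carrier R}"

definition regular_couple ::
    "('a, 'm) ring_scheme \<Rightarrow> 'a \<Rightarrow> nat \<Rightarrow> ('a \<Rightarrow> complex) \<Rightarrow> ('a \<Rightarrow> complex) \<Rightarrow> bool"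
  where "regular_couple R w r \<mu> \<mu>' \<longleftrightarrow>
    \<mu> \<in> hom (units_of R) complex_units \<and> \<mu>' \<in> hom (units_of R) complex_units \<and>
    (\<exists>u \<in> congruence_units R w (r - 1). \<mu> u * inverse (\<mu>' u) \<noteq> 1)"

definition split_subgroup :: "('a, 'm) ring_scheme \<Rightarrow> 'a \<Rightarrow> nat \<Rightarrow> 'a mat2 set"
  where "split_subgroup R w l =
    {(s1, w [^]\<^bsub>R\<^esub> l \<otimes>\<^bsub>R\<^esub> y, w [^]\<^bsub>R\<^esub> l \<otimes>\<^bsub>R\<^esub> z, s2) |s1 s2 y z.
      s1 \<in> Units R \<and> s2 \<in> Units R \<and> y \<in> carrier R \<and> z \<in> carrier R}"

definition box_character :: "('a \<Rightarrow> complex) \<Rightarrow> ('a \<Rightarrow> complex) \<Rightarrow> 'a mat2 \<Rightarrow> complex"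
  where "box_character \<mu> \<mu>' = (\<lambda>(a, b, c, d). \<mu> a * \<mu>' d)"

definition principal_split_character ::
    "('a, 'm) ring_scheme \<Rightarrow> 'a \<Rightarrow> nat \<Rightarrow> ('a \<Rightarrow> complex) \<Rightarrow> ('a \<Rightarrow> complex) \<Rightarrow> 'a mat2 \<Rightarrow> complex"
  where "principal_split_character R w r \<mu> \<mu>' =
    ind_character (GL2 R) (split_subgroup R w (r div 2)) (box_character \<mu> \<mu>')"

definition C_matrix :: "('a, 'm) ring_scheme \<Rightarrow> 'a \<Rightarrow> 'a \<Rightarrow> nat \<Rightarrow> 'a \<Rightarrow> 'a \<Rightarrow> 'a mat2"
  where "C_matrix R w \<epsilon> i \<alpha> \<beta> =
    (\<alpha>, w [^]\<^bsub>R\<^esub> i \<otimes>\<^bsub>R\<^esub> \<epsilon> \<otimes>\<^bsub>R\<^esub> \<beta>, w [^]\<^bsub>R\<^esub> i \<otimes>\<^bsub>R\<^esub> \<beta>, \<alpha>)"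

end

theory Submission
  imports Defs
begin

text \<open>
  Put \<open>l = r / 2\<close> and let \<open>Y\<close> be the matrix with rows \<open>(0, \<epsilon>)\<close> and \<open>(1, 0)\<close>, so that
  \<open>Y\<^sup>2 = \<epsilon>\<close> and \<open>C = \<alpha> + w\<^sup>i \<beta> Y\<close>. By the Frobenius formula (\<open>ind_character_formula\<close>) the character
  is, up to the factor \<open>1 / |T|\<close>, the sum of \<open>(\<mu> \<boxtimes> \<mu>') (x C x\<inverse>)\<close> over those \<open>x\<close> in the group with
  \<open>x C x\<inverse> \<in> T\<close>. Here \<open>x C x\<inverse> = \<alpha> + w\<^sup>i \<beta> Z\<close> with \<open>Z = x Y x\<inverse>\<close>, and \<open>Z\<^sup>2 = \<epsilon>\<close>.

  The key point (\<open>companion_conj_entries\<close>) is that \<open>Z\<close> has rows \<open>(a, b)\<close> and \<open>(c, -a)\<close> with \<open>c\<close> a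
  unit: from \<open>a\<^sup>2 + b c = \<epsilon>\<close>, if \<open>c\<close> were a multiple of \<open>w\<close> then \<open>\<epsilon>\<close> would be a square modulo \<open>w\<close>,
  and then a square by Hensel's lemma (\<open>square_if_square_mod\<close>), the residue characteristic being odd.

  If \<open>i < l\<close>, the entry \<open>w\<^sup>i \<beta> c\<close> is not a multiple of \<open>w\<^sup>l\<close>, so the sum is empty.

  If \<open>i \<ge> l\<close>, then \<open>\<alpha>\<close> is a unit, all conjugates lie in \<open>T\<close>, and the summand is
  \<open>\<mu> (\<alpha> + w\<^sup>i \<beta> a) \<mu>' (\<alpha> - w\<^sup>i \<beta> a)\<close>. Multiplying \<open>x\<close> on the left by the transvection with parameter
  \<open>\<kappa> / c\<close> replaces \<open>a\<close> by \<open>a + \<kappa>\<close> and fixes \<open>c\<close>, so it is a permutation of the group for each fixed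
  \<open>\<kappa>\<close>. Regularity provides a \<open>u = 1 + \<delta>\<close>, with \<open>\<delta>\<close> a multiple of \<open>w\<^bsup>r-1\<^esup>\<close>, such that
  \<open>\<mu> u \<noteq> \<mu>' u\<close>; taking \<open>\<kappa>\<close> with \<open>w\<^sup>i \<beta> \<kappa> = \<alpha> \<delta>\<close>, the two arguments get multiplied by \<open>u\<close> and
  \<open>u\<inverse>\<close>. The sum is therefore equal to \<open>\<mu> u / \<mu>' u\<close> times itself, hence zero.
\<close>

section \<open>Traces and induced characters of finite groups\<close>

lemma sum_fun_apply: "(\<Sum>i\<in>I. f i) x = (\<Sum>i\<in>I. f i x)" for f :: "'i \<Rightarrow> 'a \<Rightarrow> complex"
  by (induction I rule: infinite_finite_induct) auto

text \<open>A family \<open>e\<close> that expands every \<open>f \<in> V\<close> with its own values \<open>f y\<close> as coefficients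
  behaves like a basis with its dual basis, even though it is usually linearly dependent. For any
  genuine basis \<open>B\<close>, expand \<open>T b\<close> in the family, read off the \<open>b\<close>-coordinate, and exchange the
  sums: the inner sum over \<open>B\<close> reassembles \<open>e y\<close>, so the basis disappears. This is why the
  arbitrary choice of \<open>B\<close> in the definition of the trace is harmless.\<close>

lemma trace_on_eq_sum_reproducing:
  fixes V :: "('a \<Rightarrow> complex) set" and e :: "'a \<Rightarrow> 'a \<Rightarrow> complex"
  assumes V: "cfun.subspace V" and fin: "finite Y"
    and e: "\<And>y. y \<in> Y \<Longrightarrow> e y \<in> V"
    and repr: "\<And>f. f \<in> V \<Longrightarrow> f = (\<Sum>y\<in>Y. (\<lambda>x. f y * e y x))"
    and T: "\<And>f. f \<in> V \<Longrightarrow> T f \<in> V"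
    and \<phi>: "\<And>f y. f \<in> V \<Longrightarrow> y \<in> Y \<Longrightarrow> T f y = f (\<phi> y)"
  shows "trace_on V T = (\<Sum>y\<in>Y. e y (\<phi> y))"
proof -
  define B where "B = (SOME B. cfun.independent B \<and> cfun.span B = V)"
  have "\<exists>B. cfun.independent B \<and> cfun.span B = V"
    using cfun.basis_exists[of V] cfun.span_subspace V by metis
  hence B: "cfun.independent B" "cfun.span B = V"
    unfolding B_def by (metis (mono_tags, lifting) someI_ex)+
  have BV: "B \<subseteq> V"
    using B(2) cfun.span_superset by blast
  have "V \<subseteq> cfun.span (e ` Y)"
  proof
    fix f assume "f \<in> V"
    have "(\<Sum>y\<in>Y. (\<lambda>x. f y * e y x)) \<in> cfun.span (e ` Y)"
      by (intro cfun.span_sum cfun.span_scale cfun.span_base imageI)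
    thus "f \<in> cfun.span (e ` Y)"
      using repr[OF \<open>f \<in> V\<close>] by simp
  qed
  hence finB: "finite B"
    using cfun.independent_span_bound[of "e ` Y" B] B(1) BV fin by auto
  let ?rep = "cfun.representation B"
  have "trace_on V T = (\<Sum>b\<in>B. ?rep (T b) b)"
    by (simp add: trace_on_def B_def Let_def)
  also have "\<dots> = (\<Sum>b\<in>B. \<Sum>y\<in>Y. b (\<phi> y) * ?rep (e y) b)"
  proof (rule sum.cong[OF refl])
    fix b assume b: "b \<in> B"
    hence bV: "b \<in> V" using BV by auto
    have "?rep (T b) b = ?rep (\<Sum>y\<in>Y. (\<lambda>x. T b y * e y x)) b"
      using repr[OF T[OF bV]] by simp
    also have "\<dots> = (\<Sum>y\<in>Y. ?rep (\<lambda>x. T b y * e y x) b)"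
      by (subst cfun.representation_sum[OF B(1)])
         (use e B(2) in \<open>auto intro!: cfun.span_scale\<close>)
    also have "\<dots> = (\<Sum>y\<in>Y. b (\<phi> y) * ?rep (e y) b)"
      by (intro sum.cong refl, subst cfun.representation_scale[OF B(1)])
         (use e B(2) \<phi>[OF bV] in auto)
    finally show "?rep (T b) b = (\<Sum>y\<in>Y. b (\<phi> y) * ?rep (e y) b)" .
  qed
  also have "\<dots> = (\<Sum>y\<in>Y. \<Sum>b\<in>B. ?rep (e y) b * b (\<phi> y))"
    by (subst sum.swap) (simp add: mult.commute)
  also have "\<dots> = (\<Sum>y\<in>Y. e y (\<phi> y))"
  proof (rule sum.cong[OF refl])
    fix y assume "y \<in> Y"
    hence "(\<Sum>b\<in>B. (\<lambda>x. ?rep (e y) b * b x)) = e y"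
      using cfun.sum_representation_eq[OF B(1) _ finB subset_refl] e B(2) by blast
    from fun_cong[OF this, of "\<phi> y"]
    show "(\<Sum>b\<in>B. ?rep (e y) b * b (\<phi> y)) = e y (\<phi> y)"
      by (simp add: sum_fun_apply)
  qed
  finally show ?thesis .
qed

text \<open>The Frobenius formula for an induced character. The reproducing family is
  \<open>e y x = \<chi> (x y\<inverse>) / |H|\<close>, supported on the coset \<open>H y\<close>; each coset thus carries \<open>|H|\<close> proportional
  functions, and the denominator compensates for that. Summing over all of \<open>G\<close> rather than over
  coset representatives avoids choosing representatives.\<close>

lemma (in group) ind_character_formula:
  assumes fin: "finite (carrier G)" and H: "subgroup H G"
    and \<chi>: "\<And>h k. h \<in> H \<Longrightarrow> k \<in> H \<Longrightarrow> \<chi> (h \<otimes> k) = \<chi> h * \<chi> k" and one: "\<chi> \<one> = 1"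
    and g: "g \<in> carrier G"
  shows "ind_character G H \<chi> g =
    (\<Sum>x\<in>carrier G. if x \<otimes> g \<otimes> inv x \<in> H then \<chi> (x \<otimes> g \<otimes> inv x) else 0) / card H"
proof -
  interpret H: subgroup H G by fact
  let ?V = "ind_space G H \<chi>"
  define e where "e y = (\<lambda>x. if x \<in> carrier G \<and> x \<otimes> inv y \<in> H
      then \<chi> (x \<otimes> inv y) / card H else 0)" for y
  have cardH: "card H \<noteq> 0"
    using card_0_eq[OF finite_subset[OF H.subset fin]] H.one_closed by blast
  have "ind_character G H \<chi> g = (\<Sum>y\<in>carrier G. e y (y \<otimes> g))"
    unfolding ind_character_def
  proof (rule trace_on_eq_sum_reproducing)
    show "cfun.subspace ?V"
      unfolding cfun.subspace_def by (auto simp: ind_space_def algebra_simps)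
    show "finite (carrier G)" by fact
  next
    fix y assume y: "y \<in> carrier G"
    show "e y \<in> ?V"
      unfolding ind_space_def
    proof (intro CollectI conjI allI impI ballI)
      fix x assume "x \<notin> carrier G"
      thus "e y x = 0" by (simp add: e_def)
    next
      fix h x assume h: "h \<in> H" and x: "x \<in> carrier G"
      have eq: "h \<otimes> x \<otimes> inv y = h \<otimes> (x \<otimes> inv y)"
        using h x y by (simp add: m_assoc)
      have "h \<otimes> (x \<otimes> inv y) \<in> H \<longleftrightarrow> x \<otimes> inv y \<in> H"
        using h x y H.m_closed H.m_inv_closed H.mem_carrier
        by (metis inv_closed inv_solve_left m_closed)
      thus "e y (h \<otimes> x) = \<chi> h * e y x"
        using h x y \<chi> by (simp add: e_def eq)
    qed
  next
    fix f assume f: "f \<in> ?V"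
    show "f = (\<Sum>y\<in>carrier G. (\<lambda>x. f y * e y x))"
    proof
      fix x
      show "f x = (\<Sum>y\<in>carrier G. (\<lambda>x. f y * e y x)) x"
      proof (cases "x \<in> carrier G")
        case False
        thus ?thesis using f by (simp add: sum_fun_apply e_def ind_space_def)
      next
        case x: True
        have "(\<Sum>y\<in>carrier G. f y * e y x) = (\<Sum>y\<in>{y\<in>carrier G. x \<otimes> inv y \<in> H}. f x / card H)"
        proof (rule sum.mono_neutral_cong_right[OF fin])
          show "\<forall>y\<in>carrier G - {y \<in> carrier G. x \<otimes> inv y \<in> H}. f y * e y x = 0"
            by (auto simp: e_def)
          fix y assume "y \<in> {y\<in>carrier G. x \<otimes> inv y \<in> H}"
          hence y: "y \<in> carrier G" "x \<otimes> inv y \<in> H" by auto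
          have "f x = f (x \<otimes> inv y \<otimes> y)"
            using x y by (simp add: m_assoc)
          also have "\<dots> = \<chi> (x \<otimes> inv y) * f y"
            using f y by (auto simp: ind_space_def)
          finally show "f y * e y x = f x / card H"
            using x y by (simp add: e_def)
        qed auto
        also have "\<dots> = card {y\<in>carrier G. x \<otimes> inv y \<in> H} * (f x / card H)"
          by simp
        also have "card {y\<in>carrier G. x \<otimes> inv y \<in> H} = card H"
        proof (rule bij_betw_same_card[of "\<lambda>y. x \<otimes> inv y"],
               rule bij_betw_byWitness[where f' = "\<lambda>h. inv h \<otimes> x"])
          have "x \<otimes> (inv x \<otimes> h) = h" if "h \<in> carrier G" for h
            using x that by (simp flip: m_assoc)
          thus "\<forall>h\<in>H. x \<otimes> inv (inv h \<otimes> x) = h"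
            "(\<lambda>h. inv h \<otimes> x) ` H \<subseteq> {y \<in> carrier G. x \<otimes> inv y \<in> H}"
            using x by (auto simp: inv_mult_group)
        qed (use x in \<open>auto simp: inv_mult_group m_assoc\<close>)
        finally show ?thesis
          using cardH by (simp add: sum_fun_apply)
      qed
    qed
    show "ind_action G g f \<in> ?V"
      using f g by (auto simp: ind_space_def ind_action_def m_assoc)
    fix y assume "y \<in> carrier G"
    thus "ind_action G g f y = f (y \<otimes> g)"
      by (simp add: ind_action_def)
  qed
  also have "\<dots> = (\<Sum>x\<in>carrier G. (if x \<otimes> g \<otimes> inv x \<in> H then \<chi> (x \<otimes> g \<otimes> inv x) else 0) / card H)"
    using g by (intro sum.cong refl) (simp add: e_def)
  finally show ?thesis
    by (simp add: sum_divide_distrib)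
qed

section \<open>Truncated valuation rings of odd residue characteristic\<close>

text \<open>The axioms are modelled on \<open>\<O> / \<pi>\<^sup>r \<O>\<close> with \<open>w\<close> the image of \<open>\<pi>\<close>: a finite local ring whose maximal
  ideal is generated by the nilpotent \<open>w\<close>, and in which \<open>2\<close> is invertible. The zero ring is a model as well; where it has to be
  excluded, regularity of a couple of characters does so, by forcing \<open>w\<^bsup>r-1\<^esup> \<noteq> 0\<close>.\<close>

locale truncated_valuation_ring = cring +
  fixes w :: 'a and r :: nat
  assumes finite_carrier: "finite (carrier R)"
    and w_closed [simp]: "w \<in> carrier R"
    and w_pow_r: "w [^] r = \<zero>"
    and unit_or_multiple: "x \<in> carrier R \<Longrightarrow> x \<in> Units R \<or> (\<exists>y\<in>carrier R. x = w \<otimes> y)"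
    and two_unit: "\<one> \<oplus> \<one> \<in> Units R"
begin

lemma w_pow_eq_zero: "r \<le> n \<Longrightarrow> w [^] n = \<zero>"
  by (metis le_Suc_ex nat_pow_closed nat_pow_mult w_closed w_pow_r l_null)

lemma multiple_not_unit:
  assumes "\<one> \<noteq> \<zero>" and y: "y \<in> carrier R"
  shows "w \<otimes> y \<notin> Units R"
proof
  assume "w \<otimes> y \<in> Units R"
  hence "(w \<otimes> y) [^] r \<in> Units R"
    using Units_pow_closed by blast
  moreover have "(w \<otimes> y) [^] r = \<zero>"
    using y by (simp add: nat_pow_distrib w_pow_r)
  ultimately show False
    using assms(1) by (metis Units_r_inv Units_inv_closed l_null)
qed

text \<open>Hensel's lemma for \<open>x\<^sup>2 = e\<close>. If the error of an approximate root \<open>x\<close> is \<open>t = w\<^sup>k y\<close>, then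
  the Newton step \<open>x + t / (2 x)\<close> leaves the error \<open>- (t / (2 x))\<^sup>2\<close>, a multiple of \<open>w\<^sup>2\<^sup>k\<close>. Since
  \<open>w\<close> is nilpotent, finitely many steps give an exact root.\<close>

lemma square_if_square_mod:
  assumes e: "e \<in> Units R" and a: "a \<in> carrier R" and y: "y \<in> carrier R"
    and eq: "e = a \<otimes> a \<oplus> w \<otimes> y"
  shows "\<exists>x\<in>carrier R. e = x \<otimes> x"
proof (cases "\<one> = \<zero>")
  case True
  thus ?thesis using e one_zeroD by force
next
  case False
  have "\<exists>x\<in>carrier R. \<exists>y\<in>carrier R. e = x \<otimes> x \<oplus> w [^] Suc n \<otimes> y" for n
  proof (induction n)
    case 0
    thus ?case using a y eq by auto
  next
    case (Suc n)
    then obtain x y where x: "x \<in> carrier R" and y: "y \<in> carrier R"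
      and eq: "e = x \<otimes> x \<oplus> w [^] Suc n \<otimes> y" by blast
    \<comment> \<open>\<open>x\<close> is a unit since \<open>x\<^sup>2\<close> differs from the unit \<open>e\<close> by a multiple of \<open>w\<close>.\<close>
    have "x \<in> Units R"
    proof (rule ccontr)
      assume "x \<notin> Units R"
      then obtain z where z: "z \<in> carrier R" "x = w \<otimes> z"
        using unit_or_multiple x by blast
      have "e = w \<otimes> (z \<otimes> x \<oplus> w [^] n \<otimes> y)"
        using eq x y z by (simp add: r_distr m_ac)
      thus False
        using multiple_not_unit[OF False] e x y z by auto
    qed
    hence "x \<oplus> x \<in> Units R"
      using Units_m_closed[OF two_unit] x by (metis l_distr l_one one_closed)
    then obtain h where h: "h \<in> carrier R" "(x \<oplus> x) \<otimes> h = \<one>"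
      by (meson Units_inv_closed Units_r_inv)
    \<comment> \<open>\<open>h\<close> is the inverse of the derivative \<open>2 x\<close>, and \<open>t\<close> the current error.\<close>
    define t where "t = w [^] Suc n \<otimes> y"
    have t: "t \<in> carrier R" using y by (simp add: t_def)
    have "(x \<oplus> t \<otimes> h) \<otimes> (x \<oplus> t \<otimes> h) = x \<otimes> x \<oplus> t \<otimes> ((x \<oplus> x) \<otimes> h) \<oplus> (t \<otimes> t) \<otimes> (h \<otimes> h)"
      using x t h(1) by (simp add: l_distr r_distr m_ac a_ac)
    also have "\<dots> = e \<oplus> (t \<otimes> t) \<otimes> (h \<otimes> h)"
      using eq h t by (simp add: t_def)
    also have "t \<otimes> t = w [^] Suc (Suc n) \<otimes> (w [^] n \<otimes> (y \<otimes> y))"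
      using y by (simp add: t_def m_ac)
    finally have "e = (x \<oplus> t \<otimes> h) \<otimes> (x \<oplus> t \<otimes> h) \<oplus>
        w [^] Suc (Suc n) \<otimes> (\<ominus> (w [^] n \<otimes> (y \<otimes> y) \<otimes> (h \<otimes> h)))"
      using Units_closed[OF e] y h by (simp add: r_minus m_assoc a_assoc r_neg)
    thus ?case using x t h y by (metis a_inv_closed m_closed add.m_closed nat_pow_closed w_closed)
  qed
  \<comment> \<open>At exponent \<open>r + 1\<close> the error term is zero.\<close>
  then obtain x y where "x \<in> carrier R" "y \<in> carrier R" "e = x \<otimes> x \<oplus> w [^] Suc r \<otimes> y"
    by blast
  thus ?thesis using w_pow_eq_zero[of "Suc r"] by auto
qed

end

section \<open>The group of invertible two by two matrices\<close>

lemma mat2_mult [simp]: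
  "(a, b, c, d) \<otimes>\<^bsub>mat2_monoid R\<^esub> (a', b', c', d') =
    (a \<otimes>\<^bsub>R\<^esub> a' \<oplus>\<^bsub>R\<^esub> b \<otimes>\<^bsub>R\<^esub> c', a \<otimes>\<^bsub>R\<^esub> b' \<oplus>\<^bsub>R\<^esub> b \<otimes>\<^bsub>R\<^esub> d',
     c \<otimes>\<^bsub>R\<^esub> a' \<oplus>\<^bsub>R\<^esub> d \<otimes>\<^bsub>R\<^esub> c', c \<otimes>\<^bsub>R\<^esub> b' \<oplus>\<^bsub>R\<^esub> d \<otimes>\<^bsub>R\<^esub> d')"
  by (simp add: mat2_monoid_def)

lemma mat2_carrier: "carrier (mat2_monoid R) = carrier R \<times> carrier R \<times> carrier R \<times> carrier R"
  by (simp add: mat2_monoid_def)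

lemma mat2_one: "\<one>\<^bsub>mat2_monoid R\<^esub> = (\<one>\<^bsub>R\<^esub>, \<zero>\<^bsub>R\<^esub>, \<zero>\<^bsub>R\<^esub>, \<one>\<^bsub>R\<^esub>)"
  by (simp add: mat2_monoid_def)

lemma GL2_mult [simp]: "x \<otimes>\<^bsub>GL2 R\<^esub> y = x \<otimes>\<^bsub>mat2_monoid R\<^esub> y"
  by (simp add: GL2_def units_of_mult)

lemma GL2_one: "\<one>\<^bsub>GL2 R\<^esub> = \<one>\<^bsub>mat2_monoid R\<^esub>"
  by (simp add: GL2_def units_of_one)

lemma GL2_carrier: "carrier (GL2 R) = Units (mat2_monoid R)"
  by (simp add: GL2_def units_of_carrier)

context cring
begin

lemma mat2_is_monoid: "monoid (mat2_monoid R)"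
proof
  fix x y z
  assume "x \<in> carrier (mat2_monoid R)" "y \<in> carrier (mat2_monoid R)" "z \<in> carrier (mat2_monoid R)"
  thus "x \<otimes>\<^bsub>mat2_monoid R\<^esub> y \<otimes>\<^bsub>mat2_monoid R\<^esub> z = x \<otimes>\<^bsub>mat2_monoid R\<^esub> (y \<otimes>\<^bsub>mat2_monoid R\<^esub> z)"
    by (cases x; cases y; cases z) (simp add: mat2_carrier l_distr r_distr m_ac a_ac)
qed (auto simp: mat2_carrier mat2_one)

sublocale M: monoid "mat2_monoid R"
  by (rule mat2_is_monoid)

sublocale GL: group "GL2 R"
  unfolding GL2_def by (rule M.units_group)

lemma GL2_finite: "finite (carrier R) \<Longrightarrow> finite (carrier (GL2 R))"
  by (rule finite_subset[of _ "carrier (mat2_monoid R)"]) (auto simp: GL2_carrier mat2_carrier Units_def)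

lemma GL2_memI:
  assumes carr: "a \<in> carrier R" "b \<in> carrier R" "c \<in> carrier R" "d \<in> carrier R"
    and det: "a \<otimes> d \<ominus> b \<otimes> c \<in> Units R"
  shows "(a, b, c, d) \<in> carrier (GL2 R)"
proof -
  obtain e where e: "e \<in> carrier R" "e \<otimes> (a \<otimes> d \<ominus> b \<otimes> c) = \<one>"
    using det by (meson Units_inv_closed Units_l_inv)
  have "(e \<otimes> d, \<ominus> (e \<otimes> b), \<ominus> (e \<otimes> c), e \<otimes> a) \<otimes>\<^bsub>mat2_monoid R\<^esub> (a, b, c, d) = \<one>\<^bsub>mat2_monoid R\<^esub>"
    using carr e(1) e(2)[symmetric]
    by (simp add: mat2_one l_minus r_minus minus_eq r_distr m_ac l_neg r_neg a_ac)
  moreover have "(a, b, c, d) \<otimes>\<^bsub>mat2_monoid R\<^esub> (e \<otimes> d, \<ominus> (e \<otimes> b), \<ominus> (e \<otimes> c), e \<otimes> a) = \<one>\<^bsub>mat2_monoid R\<^esub>"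
    using carr e(1) e(2)[symmetric]
    by (simp add: mat2_one l_minus r_minus minus_eq r_distr m_ac l_neg r_neg a_ac)
  ultimately show ?thesis
    unfolding GL2_carrier Units_def mat2_carrier using carr e(1)
    by (intro CollectI conjI bexI[of _ "(e \<otimes> d, \<ominus> (e \<otimes> b), \<ominus> (e \<otimes> c), e \<otimes> a)"]) auto
qed

text \<open>Because \<open>w\<^sup>2\<^sup>l = 0\<close>, the two off-diagonal entries never contribute to the diagonal of a
  product, whose diagonal is therefore the product of the diagonals. This makes the
  set closed under multiplication and the box character multiplicative on it.\<close>

lemma split_subgroup_is_subgroup:
  assumes w: "w \<in> carrier R" and nil: "w [^] l \<otimes> w [^] l = \<zero>"
  shows "subgroup (split_subgroup R w l) (GL2 R)"
proof (rule GL.subgroupI)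
  let ?p = "w [^] l"
  have p [simp]: "?p \<in> carrier R" using w by simp
  have nil2 [simp]: "?p \<otimes> (?p \<otimes> x) = \<zero>" if "x \<in> carrier R" for x
    using that nil by (simp flip: m_assoc)
  have mult: "(?p \<otimes> x) \<otimes> (?p \<otimes> y) = \<zero>" if "x \<in> carrier R" "y \<in> carrier R" for x y
    using that nil2[of "x \<otimes> y"] by (simp add: m_ac)
  note U = Units_closed
  show sub: "split_subgroup R w l \<subseteq> carrier (GL2 R)"
    by (auto simp: split_subgroup_def mult minus_eq U intro!: GL2_memI)
  have "(\<one>, ?p \<otimes> \<zero>, ?p \<otimes> \<zero>, \<one>) \<in> split_subgroup R w l"
    unfolding split_subgroup_def by blast
  thus "split_subgroup R w l \<noteq> {}" by blast
  fix x assume "x \<in> split_subgroup R w l"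
  then obtain s t y z where x: "x = (s, ?p \<otimes> y, ?p \<otimes> z, t)"
    and st: "s \<in> Units R" "t \<in> Units R" and yz: "y \<in> carrier R" "z \<in> carrier R"
    by (auto simp: split_subgroup_def)
  note stc = st[THEN Units_closed] st[THEN Units_inv_closed]
  let ?x' = "(inv s, ?p \<otimes> (\<ominus> (inv s \<otimes> inv t \<otimes> y)), ?p \<otimes> (\<ominus> (inv s \<otimes> inv t \<otimes> z)), inv t)"
  have x': "?x' \<in> split_subgroup R w l"
    unfolding split_subgroup_def using st yz stc by blast
  have "?x' \<otimes>\<^bsub>mat2_monoid R\<^esub> x = \<one>\<^bsub>mat2_monoid R\<^esub>"
  proof -
    have "inv s \<otimes> (?p \<otimes> y) \<oplus> ?p \<otimes> (\<ominus> (inv s \<otimes> inv t \<otimes> y)) \<otimes> t =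
        inv s \<otimes> (?p \<otimes> y) \<oplus> \<ominus> (inv s \<otimes> (?p \<otimes> y) \<otimes> (inv t \<otimes> t))"
      using stc yz by (simp add: r_minus l_minus m_ac del: Units_l_inv)
    moreover have "?p \<otimes> (\<ominus> (inv s \<otimes> inv t \<otimes> z)) \<otimes> s \<oplus> inv t \<otimes> (?p \<otimes> z) =
        \<ominus> (inv t \<otimes> (?p \<otimes> z) \<otimes> (inv s \<otimes> s)) \<oplus> inv t \<otimes> (?p \<otimes> z)"
      using stc yz by (simp add: r_minus l_minus m_ac del: Units_l_inv)
    ultimately show ?thesis
      using st stc yz by (simp add: x mat2_one mult l_neg r_neg)
  qed
  hence "inv\<^bsub>GL2 R\<^esub> x = ?x'"
    using GL.inv_equality[of ?x' x] x' sub \<open>x \<in> split_subgroup R w l\<close> by (auto simp: GL2_one)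
  thus "inv\<^bsub>GL2 R\<^esub> x \<in> split_subgroup R w l" using x' by simp
  fix x2 assume "x2 \<in> split_subgroup R w l"
  then obtain s2 t2 y2 z2 where x2: "x2 = (s2, ?p \<otimes> y2, ?p \<otimes> z2, t2)"
    and st2: "s2 \<in> Units R" "t2 \<in> Units R" and yz2: "y2 \<in> carrier R" "z2 \<in> carrier R"
    by (auto simp: split_subgroup_def)
  note stc2 = st2[THEN Units_closed]
  have "x \<otimes>\<^bsub>GL2 R\<^esub> x2 = (s \<otimes> s2, ?p \<otimes> (s \<otimes> y2 \<oplus> y \<otimes> t2), ?p \<otimes> (z \<otimes> s2 \<oplus> t \<otimes> z2), t \<otimes> t2)"
    using stc stc2 yz yz2 by (simp add: x x2 mult r_distr m_ac nil)
  thus "x \<otimes>\<^bsub>GL2 R\<^esub> x2 \<in> split_subgroup R w l"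
    unfolding split_subgroup_def using st st2 yz yz2 stc stc2 by blast
qed

lemma box_character_mult:
  assumes w: "w \<in> carrier R" and nil: "w [^] l \<otimes> w [^] l = \<zero>"
    and \<mu>: "\<mu> \<in> hom (units_of R) complex_units" and \<mu>': "\<mu>' \<in> hom (units_of R) complex_units"
    and h: "h \<in> split_subgroup R w l" and k: "k \<in> split_subgroup R w l"
  shows "box_character \<mu> \<mu>' (h \<otimes>\<^bsub>GL2 R\<^esub> k) = box_character \<mu> \<mu>' h * box_character \<mu> \<mu>' k"
proof -
  have p [simp]: "w [^] l \<in> carrier R" using w by simp
  have mult: "(w [^] l \<otimes> x) \<otimes> (w [^] l \<otimes> y) = \<zero>" if "x \<in> carrier R" "y \<in> carrier R" for x y
  proof -
    have "(w [^] l \<otimes> x) \<otimes> (w [^] l \<otimes> y) = (w [^] l \<otimes> w [^] l) \<otimes> (x \<otimes> y)"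
      using that p by (simp add: m_ac)
    thus ?thesis using that nil by simp
  qed
  have "\<nu> (a \<otimes> b) = \<nu> a * \<nu> b"
    if "\<nu> \<in> hom (units_of R) complex_units" "a \<in> Units R" "b \<in> Units R" for \<nu> a b
    using that by (auto simp: hom_def complex_units_def units_of_def)
  from this[OF \<mu>] this[OF \<mu>'] show ?thesis
    using h k by (auto simp: split_subgroup_def box_character_def mult Units_closed)
qed

end

section \<open>Conjugates of the nonsplit matrix\<close>

definition mat2_comb :: "('a, 'm) ring_scheme \<Rightarrow> 'a \<Rightarrow> 'a mat2 \<Rightarrow> 'a \<Rightarrow> 'a mat2 \<Rightarrow> 'a mat2"
  where "mat2_comb R s = (\<lambda>(a, b, c, d) t (a', b', c', d').
    (s \<otimes>\<^bsub>R\<^esub> a \<oplus>\<^bsub>R\<^esub> t \<otimes>\<^bsub>R\<^esub> a', s \<otimes>\<^bsub>R\<^esub> b \<oplus>\<^bsub>R\<^esub> t \<otimes>\<^bsub>R\<^esub> b',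
     s \<otimes>\<^bsub>R\<^esub> c \<oplus>\<^bsub>R\<^esub> t \<otimes>\<^bsub>R\<^esub> c', s \<otimes>\<^bsub>R\<^esub> d \<oplus>\<^bsub>R\<^esub> t \<otimes>\<^bsub>R\<^esub> d'))"

context cring
begin

lemma mat2_comb_mult_left:
  assumes "s \<in> carrier R" "t \<in> carrier R" "A \<in> carrier (mat2_monoid R)"
    "B \<in> carrier (mat2_monoid R)" "P \<in> carrier (mat2_monoid R)"
  shows "P \<otimes>\<^bsub>mat2_monoid R\<^esub> mat2_comb R s A t B =
    mat2_comb R s (P \<otimes>\<^bsub>mat2_monoid R\<^esub> A) t (P \<otimes>\<^bsub>mat2_monoid R\<^esub> B)"
  using assms
  by (cases A; cases B; cases P) (simp add: mat2_comb_def mat2_carrier r_distr m_ac a_ac)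

lemma mat2_comb_mult_right:
  assumes "s \<in> carrier R" "t \<in> carrier R" "A \<in> carrier (mat2_monoid R)"
    "B \<in> carrier (mat2_monoid R)" "P \<in> carrier (mat2_monoid R)"
  shows "mat2_comb R s A t B \<otimes>\<^bsub>mat2_monoid R\<^esub> P =
    mat2_comb R s (A \<otimes>\<^bsub>mat2_monoid R\<^esub> P) t (B \<otimes>\<^bsub>mat2_monoid R\<^esub> P)"
  using assms
  by (cases A; cases B; cases P) (simp add: mat2_comb_def mat2_carrier r_distr l_distr m_ac a_ac)

lemma GL2_in_mat2: "x \<in> carrier (GL2 R) \<Longrightarrow> x \<in> carrier (mat2_monoid R)"
  by (simp add: GL2_carrier M.Units_closed)

lemma GL2_mat2_inv:
  assumes "x \<in> carrier (GL2 R)"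
  shows "x \<otimes>\<^bsub>mat2_monoid R\<^esub> inv\<^bsub>GL2 R\<^esub> x = \<one>\<^bsub>mat2_monoid R\<^esub>"
    "inv\<^bsub>GL2 R\<^esub> x \<otimes>\<^bsub>mat2_monoid R\<^esub> x = \<one>\<^bsub>mat2_monoid R\<^esub>"
    "inv\<^bsub>GL2 R\<^esub> x \<in> carrier (mat2_monoid R)"
  using GL.r_inv[OF assms] GL.l_inv[OF assms] GL2_in_mat2[OF GL.inv_closed[OF assms]]
  by (simp_all add: GL2_one)

end

context truncated_valuation_ring
begin

text \<open>A matrix of trace zero whose square is the scalar \<open>e\<close> cannot be triangular modulo \<open>w\<close>: its
  diagonal entry would be a square root of \<open>e\<close> modulo \<open>w\<close>, and Hensel's lemma would lift it. This
  is where the hypothesis that \<open>e\<close> is not a square enters.\<close>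

lemma offdiagonal_unit:
  assumes e: "e \<in> Units R" "\<not> (\<exists>x\<in>carrier R. e = x \<otimes> x)"
    and carr: "a \<in> carrier R" "b \<in> carrier R" "c \<in> carrier R"
    and eq: "a \<otimes> a \<oplus> b \<otimes> c = e"
  shows "c \<in> Units R"
proof (rule ccontr)
  assume "c \<notin> Units R"
  then obtain y where "y \<in> carrier R" "c = w \<otimes> y"
    using unit_or_multiple carr by blast
  hence "e = a \<otimes> a \<oplus> w \<otimes> (b \<otimes> y)"
    using eq carr by (simp add: m_ac)
  thus False
    using square_if_square_mod[OF e(1), of a "b \<otimes> y"] e(2) carr \<open>y \<in> carrier R\<close> by blast
qed

text \<open>The conjugate \<open>x Y x\<inverse>\<close>, where \<open>Y\<close> has rows \<open>(0, e)\<close> and \<open>(1, 0)\<close>, so that \<open>Y\<^sup>2 = e\<close>.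
  The matrix \<open>C\<close> of the character formula is \<open>\<alpha> + w\<^sup>i \<beta> Y\<close>.\<close>

definition companion_conj :: "'a \<Rightarrow> 'a mat2 \<Rightarrow> 'a mat2" where
  "companion_conj e x = x \<otimes>\<^bsub>mat2_monoid R\<^esub> (\<zero>, e, \<one>, \<zero>) \<otimes>\<^bsub>mat2_monoid R\<^esub> inv\<^bsub>GL2 R\<^esub> x"

lemma companion_conj_closed: "e \<in> carrier R \<Longrightarrow> x \<in> carrier (GL2 R) \<Longrightarrow> companion_conj e x \<in> carrier (mat2_monoid R)"
  unfolding companion_conj_def using GL2_in_mat2 GL2_mat2_inv(3)
  by (intro M.m_closed) (auto simp: mat2_carrier)

text \<open>Everything follows from the fact that \<open>Z = x Y x\<inverse>\<close> satisfies \<open>Z\<^sup>2 = e\<close>. The diagonal of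
  this equation makes the lower left entry \<open>c\<close> a unit, and the entry \<open>c (a + d) = 0\<close> then gives
  trace zero without computing the trace of a conjugate.\<close>

lemma companion_conj_entries:
  assumes e: "e \<in> Units R" "\<not> (\<exists>x\<in>carrier R. e = x \<otimes> x)" and x: "x \<in> carrier (GL2 R)"
  obtains a b c where "companion_conj e x = (a, b, c, \<ominus> a)"
    "a \<in> carrier R" "b \<in> carrier R" "c \<in> Units R"
proof -
  let ?M = "mat2_monoid R"
  note ec = Units_closed[OF e(1)]
  let ?Y = "(\<zero>, e, \<one>, \<zero>)" and ?E = "(e, \<zero>, \<zero>, e)"
  have Y: "?Y \<in> carrier ?M" and E: "?E \<in> carrier ?M" using ec by (auto simp: mat2_carrier)
  note xM = GL2_in_mat2[OF x] and xi = GL2_mat2_inv[OF x]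
  have YY: "?Y \<otimes>\<^bsub>?M\<^esub> ?Y = ?E" using ec by simp
  have "companion_conj e x \<otimes>\<^bsub>?M\<^esub> companion_conj e x = x \<otimes>\<^bsub>?M\<^esub> ?Y \<otimes>\<^bsub>?M\<^esub> (inv\<^bsub>GL2 R\<^esub> x \<otimes>\<^bsub>?M\<^esub> x) \<otimes>\<^bsub>?M\<^esub> ?Y \<otimes>\<^bsub>?M\<^esub> inv\<^bsub>GL2 R\<^esub> x"
    using xM xi(3) Y by (simp add: companion_conj_def M.m_assoc del: mat2_mult)
  also have "\<dots> = x \<otimes>\<^bsub>?M\<^esub> ?E \<otimes>\<^bsub>?M\<^esub> inv\<^bsub>GL2 R\<^esub> x"
    using xM xi Y YY by (simp add: M.m_assoc del: mat2_mult)
  also have "x \<otimes>\<^bsub>?M\<^esub> ?E = ?E \<otimes>\<^bsub>?M\<^esub> x"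
    using xM ec by (cases x) (simp add: mat2_carrier m_comm)
  also have "?E \<otimes>\<^bsub>?M\<^esub> x \<otimes>\<^bsub>?M\<^esub> inv\<^bsub>GL2 R\<^esub> x = ?E"
    using xM xi E by (simp add: M.m_assoc del: mat2_mult)
  finally have ZZ: "companion_conj e x \<otimes>\<^bsub>?M\<^esub> companion_conj e x = ?E" .
  obtain a b c d where Z: "companion_conj e x = (a, b, c, d)" by (cases "companion_conj e x") auto
  hence carr: "a \<in> carrier R" "b \<in> carrier R" "c \<in> carrier R" "d \<in> carrier R"
    using companion_conj_closed[OF ec x] by (auto simp: mat2_carrier)
  have eqs: "a \<otimes> a \<oplus> b \<otimes> c = e" "c \<otimes> a \<oplus> d \<otimes> c = \<zero>"
    using ZZ by (simp_all add: Z)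
  have c: "c \<in> Units R"
    using offdiagonal_unit[OF e carr(1,2,3) eqs(1)] .
  have "c \<otimes> (a \<oplus> d) = c \<otimes> \<zero>"
    using eqs(2) carr by (simp add: r_distr m_comm)
  hence "a \<oplus> d = \<zero>"
    using c carr by (subst (asm) Units_l_cancel) auto
  hence "d = \<ominus> a"
    using carr by (metis a_comm minus_equality)
  thus thesis using that Z carr c by blast
qed

text \<open>Conjugation by a transvection moves the diagonal entry \<open>a\<close> by \<open>s c\<close> and keeps \<open>c\<close>. When
  \<open>c\<close> is a unit, a suitable \<open>s\<close> realises any prescribed shift of \<open>a\<close>.\<close>

lemma companion_conj_transvection:
  assumes e: "e \<in> carrier R" and x: "x \<in> carrier (GL2 R)"
    and Z: "companion_conj e x = (a, b, c, \<ominus> a)"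
    and s: "s \<in> carrier R"
  shows "(\<one>, s, \<zero>, \<one>) \<in> carrier (GL2 R)"
    and "\<exists>b'. companion_conj e ((\<one>, s, \<zero>, \<one>) \<otimes>\<^bsub>mat2_monoid R\<^esub> x) = (a \<oplus> s \<otimes> c, b', c, \<ominus> (a \<oplus> s \<otimes> c))"
proof -
  let ?M = "mat2_monoid R"
  have carr: "a \<in> carrier R" "b \<in> carrier R" "c \<in> carrier R"
    using companion_conj_closed[OF e x] Z by (auto simp: mat2_carrier)
  let ?n = "(\<one>, s, \<zero>, \<one>)" and ?n' = "(\<one>, \<ominus> s, \<zero>, \<one>)" and ?Y = "(\<zero>, e, \<one>, \<zero>)"
  have Y: "?Y \<in> carrier ?M" using e by (auto simp: mat2_carrier)
  have n: "?n \<in> carrier (GL2 R)" "?n' \<in> carrier (GL2 R)"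
    using s by (auto intro!: GL2_memI simp: minus_eq)
  thus "?n \<in> carrier (GL2 R)" by simp
  have "inv\<^bsub>GL2 R\<^esub> ?n = ?n'"
    using s n by (intro GL.inv_equality) (auto simp: GL2_one mat2_one l_neg r_neg)
  hence inv: "inv\<^bsub>GL2 R\<^esub> (?n \<otimes>\<^bsub>?M\<^esub> x) = inv\<^bsub>GL2 R\<^esub> x \<otimes>\<^bsub>?M\<^esub> ?n'"
    using GL.inv_mult_group[OF n(1) x] by simp
  have "companion_conj e (?n \<otimes>\<^bsub>?M\<^esub> x) = ?n \<otimes>\<^bsub>?M\<^esub> companion_conj e x \<otimes>\<^bsub>?M\<^esub> ?n'"
    unfolding companion_conj_def inv using GL2_in_mat2[OF x] GL2_mat2_inv(3)[OF x] n[THEN GL2_in_mat2] Y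
    by (simp add: M.m_assoc del: mat2_mult)
  also have "\<dots> = (a \<oplus> s \<otimes> c, (a \<oplus> s \<otimes> c) \<otimes> (\<ominus> s) \<oplus> (b \<oplus> s \<otimes> (\<ominus> a)), c, \<ominus> (a \<oplus> s \<otimes> c))"
    using carr s by (simp add: Z r_minus minus_add m_comm a_comm)
  finally show "\<exists>b'. companion_conj e (?n \<otimes>\<^bsub>?M\<^esub> x) = (a \<oplus> s \<otimes> c, b', c, \<ominus> (a \<oplus> s \<otimes> c))" by blast
qed

lemma companion_conj_C_matrix:
  assumes e: "e \<in> carrier R" and x: "x \<in> carrier (GL2 R)"
    and ab: "\<alpha> \<in> carrier R" "\<beta> \<in> carrier R"
  shows "x \<otimes>\<^bsub>GL2 R\<^esub> C_matrix R w e i \<alpha> \<beta> \<otimes>\<^bsub>GL2 R\<^esub> inv\<^bsub>GL2 R\<^esub> x =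
    mat2_comb R \<alpha> \<one>\<^bsub>mat2_monoid R\<^esub> (w [^] i \<otimes> \<beta>) (companion_conj e x)"
proof -
  let ?M = "mat2_monoid R"
  let ?Y = "(\<zero>, e, \<one>, \<zero>)"
  have Y: "?Y \<in> carrier ?M" using e by (auto simp: mat2_carrier)
  have C: "C_matrix R w e i \<alpha> \<beta> = mat2_comb R \<alpha> \<one>\<^bsub>?M\<^esub> (w [^] i \<otimes> \<beta>) ?Y"
    using e ab by (simp add: C_matrix_def mat2_comb_def mat2_one m_ac)
  have \<omega>: "w [^] i \<otimes> \<beta> \<in> carrier R" using ab by simp
  show ?thesis
    unfolding GL2_mult C companion_conj_def
    using GL2_in_mat2[OF x] GL2_mat2_inv[OF x] Y ab \<omega>
    by (simp add: mat2_comb_mult_left mat2_comb_mult_right M.m_closed del: mat2_mult)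
qed

text \<open>The lower left entry of \<open>x C x\<inverse>\<close> is \<open>w\<^sup>i\<close> times the unit \<open>\<beta> c\<close>, hence not a multiple of \<open>w\<^sup>l\<close>
  when \<open>i < l\<close>.\<close>

lemma companion_conj_C_matrix_not_in_split_subgroup:
  assumes e: "e \<in> Units R" "\<not> (\<exists>x\<in>carrier R. e = x \<otimes> x)" and x: "x \<in> carrier (GL2 R)"
    and ab: "\<alpha> \<in> carrier R" "\<beta> \<in> Units R"
    and i: "i < l" "i < r" and nz: "w [^] (r - 1) \<noteq> \<zero>"
  shows "x \<otimes>\<^bsub>GL2 R\<^esub> C_matrix R w e i \<alpha> \<beta> \<otimes>\<^bsub>GL2 R\<^esub> inv\<^bsub>GL2 R\<^esub> x \<notin> split_subgroup R w l"
proof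
  assume "x \<otimes>\<^bsub>GL2 R\<^esub> C_matrix R w e i \<alpha> \<beta> \<otimes>\<^bsub>GL2 R\<^esub> inv\<^bsub>GL2 R\<^esub> x \<in> split_subgroup R w l"
  moreover obtain a b c where Z: "companion_conj e x = (a, b, c, \<ominus> a)"
    "a \<in> carrier R" "b \<in> carrier R" "c \<in> Units R"
    using companion_conj_entries[OF e x] .
  ultimately obtain z where z: "z \<in> carrier R" "w [^] i \<otimes> \<beta> \<otimes> c = w [^] l \<otimes> z"
    using ab unfolding companion_conj_C_matrix[OF Units_closed[OF e(1)] x ab(1) Units_closed[OF ab(2)]]
    by (auto simp: mat2_comb_def mat2_one split_subgroup_def Units_closed)
  have u: "\<beta> \<otimes> c \<in> Units R" using ab Z by simp
  define y where "y = inv (\<beta> \<otimes> c)"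
  have y: "y \<in> carrier R" "(\<beta> \<otimes> c) \<otimes> y = \<one>"
    using u by (simp_all add: y_def)
  have bc: "\<beta> \<in> carrier R" "c \<in> carrier R" using ab Z by auto
  \<comment> \<open>Otherwise \<open>w\<^sup>i\<close> is a multiple of \<open>w\<^sup>l\<close>, and multiplication by the complementary power of \<open>w\<close> kills \<open>w\<^bsup>r-1\<^esup>\<close>.\<close>
  have "w [^] (r - 1) = w [^] (r - 1 - i) \<otimes> (w [^] i \<otimes> ((\<beta> \<otimes> c) \<otimes> y))"
    using i y by (simp add: nat_pow_mult)
  also have "\<dots> = w [^] (r - 1 - i) \<otimes> ((w [^] i \<otimes> \<beta> \<otimes> c) \<otimes> y)"
    using bc y(1) by (simp add: m_assoc)
  also have "\<dots> = w [^] (r - 1 - i) \<otimes> w [^] l \<otimes> (z \<otimes> y)"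
    using z y(1) by (simp add: m_assoc)
  also have "w [^] (r - 1 - i) \<otimes> w [^] l = \<zero>"
    using i by (simp add: nat_pow_mult w_pow_eq_zero)
  finally show False using nz z y by simp
qed

text \<open>For \<open>i < l\<close> no conjugate of \<open>C\<close> lies in the subgroup. For \<open>i \<ge> l\<close> every conjugate lies in it,
  and the summand at \<open>x\<close> is \<open>\<mu> (\<alpha> + w\<^sup>i \<beta> a) \<mu>' (\<alpha> - w\<^sup>i \<beta> a)\<close> with \<open>a\<close> the diagonal entry of
  \<open>x Y x\<inverse>\<close>. Left multiplication by a transvection depending on \<open>x\<close> shifts \<open>a\<close> by a constant \<open>\<kappa>\<close>;
  it permutes the group and multiplies every summand by the same number \<open>\<mu> u / \<mu>' u \<noteq> 1\<close>.\<close>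

theorem principal_split_character_C_matrix:
  assumes r: "r = 2 * l" "0 < l"
    and e: "e \<in> Units R" "\<not> (\<exists>x\<in>carrier R. e = x \<otimes> x)"
    and reg: "regular_couple R w r \<mu> \<mu>'"
    and i: "i \<le> r - 1" and ab: "\<alpha> \<in> carrier R" "\<beta> \<in> Units R"
    and det: "\<alpha> [^] (2::nat) \<ominus> e \<otimes> \<beta> [^] (2::nat) \<otimes> w [^] (2 * i) \<in> Units R"
  shows "principal_split_character R w r \<mu> \<mu>' (C_matrix R w e i \<alpha> \<beta>) = 0"
proof -
  let ?M = "mat2_monoid R" and ?T = "split_subgroup R w l" and ?\<chi> = "box_character \<mu> \<mu>'"
  let ?C = "C_matrix R w e i \<alpha> \<beta>"
  define cj where "cj x = x \<otimes>\<^bsub>GL2 R\<^esub> ?C \<otimes>\<^bsub>GL2 R\<^esub> inv\<^bsub>GL2 R\<^esub> x" for x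
  note ec = Units_closed[OF e(1)] and bc = Units_closed[OF ab(2)]
  have nil: "w [^] l \<otimes> w [^] l = \<zero>"
    using r by (simp add: nat_pow_mult w_pow_eq_zero)
  have \<mu>: "\<mu> \<in> hom (units_of R) complex_units" "\<mu>' \<in> hom (units_of R) complex_units"
    using reg by (auto simp: regular_couple_def)
  have hom: "\<nu> (a \<otimes> b) = \<nu> a * \<nu> b" "\<nu> a \<noteq> 0"
    if "\<nu> \<in> hom (units_of R) complex_units" "a \<in> Units R" "b \<in> Units R" for \<nu> a b
    using that by (auto simp: hom_def complex_units_def units_of_def)
  have hom_one: "\<nu> \<one> = 1" if "\<nu> \<in> hom (units_of R) complex_units" for \<nu>
    using hom(1)[OF that, of \<one> \<one>] hom(2)[OF that, of \<one> \<one>] by simp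
  obtain x0 where x0: "x0 \<in> carrier R"
    "\<mu> (\<one> \<oplus> w [^] (r - 1) \<otimes> x0) * inverse (\<mu>' (\<one> \<oplus> w [^] (r - 1) \<otimes> x0)) \<noteq> 1"
    using reg by (auto simp: regular_couple_def congruence_units_def)
  define \<delta> where "\<delta> = w [^] (r - 1) \<otimes> x0"
  \<comment> \<open>Otherwise the only congruence unit would be \<open>1\<close>, where both characters are trivial.\<close>
  have nz: "w [^] (r - 1) \<noteq> \<zero>"
    using x0 hom_one[OF \<mu>(1)] hom_one[OF \<mu>(2)] by auto
  have CG: "?C \<in> carrier (GL2 R)"
    unfolding C_matrix_def
  proof (rule GL2_memI)
    have "w [^] i \<otimes> e \<otimes> \<beta> \<otimes> (w [^] i \<otimes> \<beta>) = e \<otimes> (\<beta> \<otimes> \<beta>) \<otimes> (w [^] i \<otimes> w [^] i)"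
      using ec bc by (simp add: m_ac)
    thus "\<alpha> \<otimes> \<alpha> \<ominus> w [^] i \<otimes> e \<otimes> \<beta> \<otimes> (w [^] i \<otimes> \<beta>) \<in> Units R"
      using det ab bc by (simp add: numeral_2_eq_2 nat_pow_mult)
  qed (use ab ec bc in auto)
  have "ind_character (GL2 R) ?T ?\<chi> ?C =
      (\<Sum>x\<in>carrier (GL2 R). if cj x \<in> ?T then ?\<chi> (cj x) else 0) / card ?T"
    unfolding cj_def
  proof (rule GL.ind_character_formula)
    show "finite (carrier (GL2 R))" by (rule GL2_finite[OF finite_carrier])
    show "subgroup ?T (GL2 R)" by (rule split_subgroup_is_subgroup[OF w_closed nil])
    show "?\<chi> (h \<otimes>\<^bsub>GL2 R\<^esub> k) = ?\<chi> h * ?\<chi> k" if "h \<in> ?T" "k \<in> ?T" for h k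
      using box_character_mult[OF w_closed nil \<mu> that] .
    show "?\<chi> \<one>\<^bsub>GL2 R\<^esub> = 1"
      using \<mu> by (simp add: GL2_one mat2_one box_character_def hom_one)
  qed (rule CG)
  also have "(\<Sum>x\<in>carrier (GL2 R). if cj x \<in> ?T then ?\<chi> (cj x) else 0) = 0"
  proof (cases "i < l")
    case True
    have "cj x \<notin> ?T" if "x \<in> carrier (GL2 R)" for x
      unfolding cj_def using companion_conj_C_matrix_not_in_split_subgroup[OF e that ab True _ nz] True r by auto
    thus ?thesis by (intro sum.neutral) auto
  next
    case False
    hence il: "l \<le> i" by simp
    define \<omega> where "\<omega> = w [^] i \<otimes> \<beta>"
    \<comment> \<open>The shift is chosen so that \<open>w\<^sup>i \<beta> \<kappa> = \<alpha> \<delta>\<close>, that is, \<open>\<alpha> (1 + \<delta>) = \<alpha> + w\<^sup>i \<beta> \<kappa>\<close>.\<close>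
    define \<kappa> where "\<kappa> = \<alpha> \<otimes> w [^] (r - 1 - i) \<otimes> x0 \<otimes> inv \<beta>"
    have carr: "\<omega> \<in> carrier R" "\<kappa> \<in> carrier R" "\<delta> \<in> carrier R" "inv \<beta> \<in> carrier R"
      using bc ab x0 by (auto simp: \<omega>_def \<kappa>_def \<delta>_def)
    have wp: "w [^] m \<otimes> x \<otimes> (w [^] n \<otimes> y) = \<zero>"
      if "r \<le> m + n" "x \<in> carrier R" "y \<in> carrier R" for m n x y
    proof -
      have "w [^] m \<otimes> x \<otimes> (w [^] n \<otimes> y) = (w [^] m \<otimes> w [^] n) \<otimes> (x \<otimes> y)"
        using that by (simp add: m_ac)
      thus ?thesis using that by (simp add: nat_pow_mult w_pow_eq_zero)
    qed
    have \<omega>\<omega>: "\<omega> \<otimes> \<omega> = \<zero>"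
      unfolding \<omega>_def using il r bc by (intro wp) auto
    have \<omega>\<delta>: "\<omega> \<otimes> \<delta> = \<zero>"
      unfolding \<omega>_def \<delta>_def using il r bc x0 by (intro wp) auto
    have \<delta>\<delta>: "\<delta> \<otimes> \<delta> = \<zero>"
      unfolding \<delta>_def using r x0 by (intro wp) auto
    have \<omega>\<kappa>: "\<omega> \<otimes> \<kappa> = \<alpha> \<otimes> \<delta>"
    proof -
      have "\<omega> \<otimes> \<kappa> = (w [^] i \<otimes> w [^] (r - 1 - i)) \<otimes> (\<alpha> \<otimes> x0) \<otimes> (\<beta> \<otimes> inv \<beta>)"
        unfolding \<omega>_def \<kappa>_def using ab(1) bc x0(1) carr(4)
        by (simp add: m_ac del: Units_r_inv)
      moreover have "i + (r - Suc i) = r - Suc 0"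
        using i r by simp
      ultimately show ?thesis
        using ab x0(1) by (simp add: nat_pow_mult \<delta>_def m_ac)
    qed
    have \<alpha>\<alpha>: "\<alpha> \<otimes> \<alpha> \<in> Units R"
      using det ab bc ec il r by (simp add: w_pow_eq_zero numeral_2_eq_2 minus_eq)
    define u where "u = \<one> \<oplus> \<delta>"
    have uc: "u \<in> carrier R" using carr by (simp add: u_def)
    have "u \<otimes> (\<one> \<ominus> \<delta>) = \<one>"
      using carr \<delta>\<delta> by (simp add: u_def minus_eq l_distr r_distr r_minus a_assoc l_neg r_neg)
    hence u: "u \<in> Units R"
      using carr uc by (metis Units_one_closed minus_closed one_closed unit_factor)
    have \<mu>u: "\<mu> u * inverse (\<mu>' u) \<noteq> 1"
      using x0 by (simp add: u_def \<delta>_def)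
    \<comment> \<open>The product of the two diagonal entries is the unit \<open>\<alpha>\<^sup>2\<close>, since \<open>\<omega>\<^sup>2 = 0\<close>.\<close>
    have diag: "\<alpha> \<oplus> \<omega> \<otimes> a \<in> Units R" "\<alpha> \<oplus> \<omega> \<otimes> (\<ominus> a) \<in> Units R" if a: "a \<in> carrier R" for a
    proof -
      have "(\<alpha> \<oplus> \<omega> \<otimes> a) \<otimes> (\<alpha> \<oplus> \<omega> \<otimes> (\<ominus> a)) = \<alpha> \<otimes> \<alpha> \<ominus> (\<omega> \<otimes> \<omega>) \<otimes> (a \<otimes> a)"
        using a ab carr by (simp add: minus_eq l_distr r_distr r_minus l_minus m_ac a_ac r_neg r_neg1 r_neg2)
      hence eq: "(\<alpha> \<oplus> \<omega> \<otimes> a) \<otimes> (\<alpha> \<oplus> \<omega> \<otimes> (\<ominus> a)) \<in> Units R"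
        using \<alpha>\<alpha> \<omega>\<omega> a ab by (simp add: minus_eq)
      show "\<alpha> \<oplus> \<omega> \<otimes> a \<in> Units R"
        using eq a ab carr by (intro unit_factor[OF eq]) auto
      show "\<alpha> \<oplus> \<omega> \<otimes> (\<ominus> a) \<in> Units R"
        by (rule unit_factor[of _ "\<alpha> \<oplus> \<omega> \<otimes> a"]) (use eq a ab carr in \<open>auto simp: m_comm\<close>)
    qed
    have cj: "cj x = (\<alpha> \<oplus> \<omega> \<otimes> a, \<omega> \<otimes> b, \<omega> \<otimes> c, \<alpha> \<oplus> \<omega> \<otimes> (\<ominus> a))"
      "cj x \<in> ?T" "a \<in> carrier R" "c \<in> carrier R"
      if x: "x \<in> carrier (GL2 R)" and Z: "companion_conj e x = (a, b, c, \<ominus> a)" for x a b c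
    proof -
      have abc: "a \<in> carrier R" "b \<in> carrier R" "c \<in> carrier R"
        using companion_conj_closed[OF ec x] by (auto simp: Z mat2_carrier)
      thus "a \<in> carrier R" "c \<in> carrier R" by auto
      show eq: "cj x = (\<alpha> \<oplus> \<omega> \<otimes> a, \<omega> \<otimes> b, \<omega> \<otimes> c, \<alpha> \<oplus> \<omega> \<otimes> (\<ominus> a))"
        unfolding cj_def companion_conj_C_matrix[OF ec x ab(1) bc]
        using ab abc carr by (simp add: Z mat2_comb_def mat2_one \<omega>_def)
      have "\<omega> \<otimes> y = w [^] l \<otimes> (w [^] (i - l) \<otimes> \<beta> \<otimes> y)" if "y \<in> carrier R" for y
        using il that bc by (simp add: \<omega>_def nat_pow_mult flip: m_assoc)
      hence "\<exists>y'\<in>carrier R. \<omega> \<otimes> y = w [^] l \<otimes> y'" if "y \<in> carrier R" for y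
        using that bc by (meson m_closed nat_pow_closed w_closed)
      then obtain y z where "y \<in> carrier R" "\<omega> \<otimes> b = w [^] l \<otimes> y"
        "z \<in> carrier R" "\<omega> \<otimes> c = w [^] l \<otimes> z"
        using abc(2,3) by metis
      thus "cj x \<in> ?T"
        using diag[OF abc(1)] by (auto simp: eq split_subgroup_def)
    qed
    \<comment> \<open>The transvection parameter is \<open>\<kappa> / c\<close>, with \<open>c\<close> the lower left entry of \<open>x Y x\<inverse>\<close>.\<close>
    define n where "n x = (\<one>, \<kappa> \<otimes> inv (fst (snd (snd (companion_conj e x)))), \<zero>, \<one>)" for x
    define \<Phi> where "\<Phi> x = n x \<otimes>\<^bsub>?M\<^esub> x" for x
    have \<Phi>: "\<exists>a b c b'. companion_conj e x = (a, b, c, \<ominus> a) \<and> companion_conj e (\<Phi> x) = (a \<oplus> \<kappa>, b', c, \<ominus> (a \<oplus> \<kappa>))"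
      "\<Phi> x \<in> carrier (GL2 R)" "n x \<in> carrier (GL2 R)"
      if x: "x \<in> carrier (GL2 R)" for x
    proof -
      obtain a b c where Z: "companion_conj e x = (a, b, c, \<ominus> a)" and c: "c \<in> Units R"
        using companion_conj_entries[OF e x] by metis
      have n: "n x = (\<one>, \<kappa> \<otimes> inv c, \<zero>, \<one>)" by (simp add: n_def Z)
      have s: "\<kappa> \<otimes> inv c \<in> carrier R" "\<kappa> \<otimes> inv c \<otimes> c = \<kappa>"
        using c carr by (simp_all add: m_assoc Units_closed)
      show nG: "n x \<in> carrier (GL2 R)"
        unfolding n by (rule companion_conj_transvection[OF ec x Z s(1)])
      show "\<Phi> x \<in> carrier (GL2 R)"
        using GL.m_closed[OF nG x] by (simp add: \<Phi>_def)
      show "\<exists>a b c b'. companion_conj e x = (a, b, c, \<ominus> a) \<and> companion_conj e (\<Phi> x) = (a \<oplus> \<kappa>, b', c, \<ominus> (a \<oplus> \<kappa>))"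
        using companion_conj_transvection(2)[OF ec x Z s(1)] Z by (simp add: \<Phi>_def n s(2))
    qed
    \<comment> \<open>\<open>c\<close> is invariant under \<open>\<Phi>\<close>, so \<open>\<Phi> x\<close> determines the transvection and hence \<open>x\<close>.\<close>
    have inj: "inj_on \<Phi> (carrier (GL2 R))"
    proof (rule inj_onI)
      fix x y assume xy: "x \<in> carrier (GL2 R)" "y \<in> carrier (GL2 R)" "\<Phi> x = \<Phi> y"
      have "n x = n y"
        using \<Phi>(1)[OF xy(1)] \<Phi>(1)[OF xy(2)] xy(3) by (auto simp: n_def)
      thus "x = y"
        using xy GL.l_cancel[of "n x" x y] \<Phi>(3) by (simp add: \<Phi>_def)
    qed
    have bij: "bij_betw \<Phi> (carrier (GL2 R)) (carrier (GL2 R))"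
      unfolding bij_betw_def
      using inj \<Phi>(2) endo_inj_surj[OF GL2_finite[OF finite_carrier] _ inj] by blast
    have scale: "?\<chi> (cj (\<Phi> x)) = (\<mu> u * inverse (\<mu>' u)) * ?\<chi> (cj x)" if x: "x \<in> carrier (GL2 R)" for x
    proof -
      obtain a b c b' where Z: "companion_conj e x = (a, b, c, \<ominus> a)"
        and Z': "companion_conj e (\<Phi> x) = (a \<oplus> \<kappa>, b', c, \<ominus> (a \<oplus> \<kappa>))"
        using \<Phi>(1)[OF x] by blast
      have a: "a \<in> carrier R" using cj(3)[OF x Z] .
      \<comment> \<open>The diagonal entries of \<open>x C x\<inverse>\<close> before and after applying \<open>\<Phi>\<close>: they become \<open>A u\<close> and \<open>D u\<inverse>\<close>.\<close>
      define A D A' D' where "A = \<alpha> \<oplus> \<omega> \<otimes> a" and "D = \<alpha> \<oplus> \<omega> \<otimes> (\<ominus> a)"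
        and "A' = \<alpha> \<oplus> \<omega> \<otimes> (a \<oplus> \<kappa>)" and "D' = \<alpha> \<oplus> \<omega> \<otimes> (\<ominus> (a \<oplus> \<kappa>))"
      note defs = A_def D_def A'_def D'_def
      have units: "A \<in> Units R" "D \<in> Units R" "A' \<in> Units R" "D' \<in> Units R"
        unfolding defs using diag a carr by auto
      have mult_\<delta>: "(\<alpha> \<oplus> \<omega> \<otimes> y) \<otimes> \<delta> = \<alpha> \<otimes> \<delta>" if "y \<in> carrier R" for y
      proof -
        have "\<omega> \<otimes> y \<otimes> \<delta> = (\<omega> \<otimes> \<delta>) \<otimes> y"
          using that carr by (simp add: m_ac)
        thus ?thesis
          using that ab carr \<omega>\<delta> by (simp add: l_distr)
      qed
      have carr': "A \<in> carrier R" "D \<in> carrier R" "D' \<in> carrier R" "\<alpha> \<otimes> \<delta> \<in> carrier R"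
        using units ab carr by (auto intro: Units_closed)
      have "A' = A \<oplus> \<alpha> \<otimes> \<delta>"
        unfolding defs using a ab carr \<omega>\<kappa> by (simp add: r_distr a_assoc)
      also have "\<dots> = A \<otimes> u"
        using mult_\<delta>[OF a] carr carr' by (simp add: u_def r_distr flip: A_def)
      finally have A': "A' = A \<otimes> u" .
      have "D' = D \<oplus> \<ominus> (\<alpha> \<otimes> \<delta>)"
        unfolding defs using a ab carr \<omega>\<kappa> by (simp add: r_distr a_assoc minus_add r_minus)
      moreover have "D' \<otimes> u = D' \<oplus> \<alpha> \<otimes> \<delta>"
        using mult_\<delta>[of "\<ominus> (a \<oplus> \<kappa>)"] a carr carr' by (simp add: u_def r_distr flip: D'_def)
      ultimately have D': "D' \<otimes> u = D"
        using carr' by (simp add: a_assoc l_neg)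
      have "?\<chi> (cj (\<Phi> x)) = \<mu> A' * \<mu>' D'"
        using cj(1)[OF \<Phi>(2)[OF x] Z'] by (simp add: defs box_character_def)
      also have "\<mu> A' = \<mu> A * \<mu> u"
        using hom(1)[OF \<mu>(1) units(1) u] A' by simp
      also have "\<mu>' D' = \<mu>' D * inverse (\<mu>' u)"
        using hom(1)[OF \<mu>(2) units(4) u] D' hom(2)[OF \<mu>(2) u u] by simp
      also have "\<mu> A * \<mu> u * (\<mu>' D * inverse (\<mu>' u)) = (\<mu> u * inverse (\<mu>' u)) * ?\<chi> (cj x)"
        using cj(1)[OF x Z] by (simp add: defs box_character_def)
      finally show ?thesis .
    qed
    have inT: "cj x \<in> ?T" if "x \<in> carrier (GL2 R)" for x
      using \<Phi>(1)[OF that] cj(2)[OF that] by blast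
    let ?S = "\<Sum>x\<in>carrier (GL2 R). ?\<chi> (cj x)"
    have "?S = (\<Sum>x\<in>carrier (GL2 R). ?\<chi> (cj (\<Phi> x)))"
      using sum.reindex_bij_betw[OF bij, of "\<lambda>x. ?\<chi> (cj x)"] by simp
    also have "\<dots> = (\<mu> u * inverse (\<mu>' u)) * ?S"
      by (simp add: scale sum_distrib_left)
    finally have "?S = 0"
      using \<mu>u by (simp add: mult_cancel_right1)
    thus ?thesis by (simp add: inT)
  qed
  finally show ?thesis
    using r by (simp add: principal_split_character_def)
qed

end

section \<open>Truncations of the ring of integers\<close>

context nonarch_local_field
begin

abbreviation \<O> where "\<O> \<equiv> val_ring F v"

lemma v_one: "v \<one> = 0"
  using v_mult[of \<one> \<one>] by simp

lemma v_inv: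
  assumes "x \<in> carrier F - {\<zero>}"
  shows "inv x \<in> carrier F - {\<zero>}" "x \<otimes> inv x = \<one>" "inv x \<otimes> x = \<one>" "v (inv x) = - v x"
proof -
  have x: "x \<in> Units F" using assms field_Units by blast
  thus inv: "inv x \<in> carrier F - {\<zero>}" "x \<otimes> inv x = \<one>" "inv x \<otimes> x = \<one>"
    using field_Units Units_inv_Units by auto
  show "v (inv x) = - v x"
    using v_mult[OF assms inv(1)] inv(2) v_one by simp
qed

lemma v_minus_one: "v (\<ominus> \<one>) = 0"
proof -
  have 1: "\<ominus> \<one> \<in> carrier F - {\<zero>}"
    using local.minus_equality by fastforce
  have "(\<ominus> \<one>) \<otimes> (\<ominus> \<one>) = \<one>"
    by (simp add: l_minus)
  thus ?thesis using v_mult[OF 1 1] v_one by simp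
qed

lemma val_ge_mult:
  assumes "x \<in> carrier F" "y \<in> carrier F" "val_ge F v m x" "val_ge F v n y"
  shows "val_ge F v (m + n) (x \<otimes> y)"
  using assms v_mult[of x y] integral_iff by (auto simp: val_ge_def)

lemma val_ge_minus:
  assumes "x \<in> carrier F" "val_ge F v n x"
  shows "val_ge F v n (\<ominus> x)"
proof -
  have "val_ge F v (0 + n) (\<ominus> \<one> \<otimes> x)"
    using assms v_minus_one by (intro val_ge_mult) (auto simp: val_ge_def)
  thus ?thesis using assms by (simp add: l_minus)
qed

lemma val_ring_simps [simp]:
  "carrier \<O> = {x \<in> carrier F. val_ge F v 0 x}" "x \<otimes>\<^bsub>\<O>\<^esub> y = x \<otimes> y" "x \<oplus>\<^bsub>\<O>\<^esub> y = x \<oplus> y"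
  "\<one>\<^bsub>\<O>\<^esub> = \<one>" "\<zero>\<^bsub>\<O>\<^esub> = \<zero>"
  by (simp_all add: val_ring_def)

lemma val_ring_pow [simp]: "x [^]\<^bsub>\<O>\<^esub> (n :: nat) = x [^] n"
  by (simp add: nat_pow_def)

lemma val_ring_cring: "cring \<O>"
proof -
  have "subring {x \<in> carrier F. val_ge F v 0 x} F"
  proof (rule subringI)
    show "\<one> \<in> {x \<in> carrier F. val_ge F v 0 x}" by (simp add: val_ge_def v_one)
  qed (use val_ge_minus val_ge_mult[of _ _ 0 0] v_add in auto)
  hence "subcring {x \<in> carrier F. val_ge F v 0 x} F"
    by (rule subcringI')
  thus ?thesis
    unfolding val_ring_def using subcring_iff[of "{x \<in> carrier F. val_ge F v 0 x}"] by auto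
qed

sublocale O: cring \<O> by (rule val_ring_cring)

context
  fixes \<pi> assumes unif: "uniformizer F v \<pi>"
begin

lemma unif_carrier: "\<pi> \<in> carrier F" "\<pi> \<noteq> \<zero>" "v \<pi> = 1"
  using unif by (auto simp: uniformizer_def)

lemma v_unif_pow: "\<pi> [^] n \<in> carrier F - {\<zero>}" "v (\<pi> [^] (n::nat)) = int n"
proof -
  show nz: "\<pi> [^] m \<in> carrier F - {\<zero>}" for m :: nat
    using unif_carrier by (induction m) (auto simp: integral_iff)
  show "v (\<pi> [^] n) = int n"
  proof (induction n)
    case (Suc n)
    thus ?case using v_mult[OF nz[of n], of \<pi>] unif_carrier by simp
  qed (simp add: v_one)
qed

lemma val_ge_iff_multiple:
  assumes "x \<in> carrier F"
  shows "val_ge F v (int n) x \<longleftrightarrow> (\<exists>y\<in>carrier \<O>. x = \<pi> [^] n \<otimes> y)"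
proof
  assume x: "val_ge F v (int n) x"
  let ?p = "\<pi> [^] n"
  note p = v_unif_pow[of n] and pi = v_inv[OF v_unif_pow(1)[of n]]
  have "x = ?p \<otimes> (inv ?p \<otimes> x)"
    using p(1) pi(1,2) assms by (simp flip: m_assoc)
  moreover have "val_ge F v (- int n + int n) (inv ?p \<otimes> x)"
    using p pi assms x by (intro val_ge_mult) (auto simp: val_ge_def)
  ultimately show "\<exists>y\<in>carrier \<O>. x = ?p \<otimes> y"
    using pi(1) assms by (intro bexI[of _ "inv ?p \<otimes> x"]) auto
next
  assume "\<exists>y\<in>carrier \<O>. x = \<pi> [^] n \<otimes> y"
  thus "val_ge F v (int n) x"
    using val_ge_mult[of "\<pi> [^] n" _ "int n" 0] v_unif_pow[of n] by (auto simp: val_ge_def)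
qed

lemma unif_pow_val_ring: "\<pi> [^] (n::nat) \<in> carrier \<O>"
  using v_unif_pow[of n] by (simp add: val_ge_def)

text \<open>The truncation ideals are the balls of the valuation. In particular the residue field is the
  truncation at level one, so facts about all levels apply to it.\<close>

lemma trunc_ideal_eq: "trunc_ideal F v \<pi> n = {x \<in> carrier F. val_ge F v (int n) x}"
  using unif_pow_val_ring[of n] val_ge_iff_multiple[of _ n]
  by (auto simp: trunc_ideal_def cgenideal_def m_comm)

lemma trunc_ideal_ideal: "ideal (trunc_ideal F v \<pi> n) \<O>"
  unfolding trunc_ideal_def using unif_pow_val_ring[of n] by (intro O.cgenideal_ideal) simp

lemma trunc_hom: "ring_hom_cring \<O> (trunc_ring F v \<pi> n) ((+>\<^bsub>\<O>\<^esub>) (trunc_ideal F v \<pi> n))"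
  unfolding trunc_ring_def by (rule ideal.rcos_ring_hom_cring[OF trunc_ideal_ideal val_ring_cring])

lemma trunc_carrier: "carrier (trunc_ring F v \<pi> n) = (+>\<^bsub>\<O>\<^esub>) (trunc_ideal F v \<pi> n) ` carrier \<O>"
  by (auto simp: trunc_ring_def FactRing_def A_RCOSETS_def')

lemma trunc_kernel:
  "x \<in> carrier F \<Longrightarrow> val_ge F v (int n) x \<Longrightarrow> trunc_ideal F v \<pi> n +>\<^bsub>\<O>\<^esub> x = \<zero>\<^bsub>trunc_ring F v \<pi> n\<^esub>"
  using O.a_rcos_zero[OF trunc_ideal_ideal, of x n] by (simp add: trunc_ideal_eq trunc_ring_def FactRing_def)

lemma trunc_zero_imp_val_ge:
  assumes "x \<in> carrier \<O>" "trunc_ideal F v \<pi> n +>\<^bsub>\<O>\<^esub> x = \<zero>\<^bsub>trunc_ring F v \<pi> n\<^esub>"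
  shows "val_ge F v (int n) x"
proof -
  have "x \<in> trunc_ideal F v \<pi> n"
    using ideal.rcos_const_imp_mem[OF trunc_ideal_ideal assms(1), of n] assms(2)
    by (simp add: trunc_ring_def FactRing_def)
  thus ?thesis by (simp add: trunc_ideal_eq)
qed

lemma residue_field_eq: "residue_field F v = trunc_ring F v \<pi> 1"
  by (simp add: residue_field_def trunc_ring_def trunc_ideal_eq)

text \<open>The first \<open>n\<close> digits of the \<open>\<pi>\<close>-adic expansion: representatives at level \<open>n + 1\<close> are
  \<open>s + \<pi>\<^sup>n t\<close>, with \<open>s\<close> a representative at level \<open>n\<close> and \<open>t\<close> one of an element of the residue field.\<close>

lemma finite_representatives:
  "\<exists>S\<subseteq>carrier \<O>. finite S \<and>
    (\<forall>x\<in>carrier \<O>. \<exists>s\<in>S. \<exists>e\<in>trunc_ideal F v \<pi> n. x = s \<oplus> e)"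
proof (induction n)
  case 0
  show ?case
    by (rule exI[of _ "{\<zero>}"]) (auto simp: trunc_ideal_eq val_ge_def)
next
  case (Suc n)
  then obtain S where S: "S \<subseteq> carrier \<O>" "finite S"
    "\<And>x. x \<in> carrier \<O> \<Longrightarrow> \<exists>s\<in>S. \<exists>e\<in>trunc_ideal F v \<pi> n. x = s \<oplus> e" by blast
  let ?h = "(+>\<^bsub>\<O>\<^esub>) (trunc_ideal F v \<pi> 1)"
  have "finite (?h ` carrier \<O>)"
    using finite_residue_field by (simp add: residue_field_eq trunc_carrier)
  then obtain Q where Q: "Q \<subseteq> carrier \<O>" "finite Q" "?h ` carrier \<O> = ?h ` Q"
    using finite_subset_image[OF _ order_refl] by metis
  let ?S = "(\<lambda>(s, t). s \<oplus> \<pi> [^] n \<otimes> t) ` (S \<times> Q)"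
  have "\<exists>s\<in>?S. \<exists>e\<in>trunc_ideal F v \<pi> (Suc n). x = s \<oplus> e" if x: "x \<in> carrier \<O>" for x
  proof -
    obtain s e where se: "s \<in> S" "e \<in> trunc_ideal F v \<pi> n" "x = s \<oplus> e"
      using S(3)[OF x] by blast
    then obtain y where y: "y \<in> carrier \<O>" "e = \<pi> [^] n \<otimes> y"
      using val_ge_iff_multiple by (auto simp: trunc_ideal_eq)
    obtain t where t: "t \<in> Q" "?h y = ?h t"
      using Q(3) y(1) by blast
    have "y \<in> ?h t"
      using abelian_subgroup.a_rcos_self[OF abelian_subgroupI3 y(1), of "trunc_ideal F v \<pi> 1"]
        t(2) ideal.axioms(1)[OF trunc_ideal_ideal] O.is_abelian_group by metis
    then obtain d where d: "d \<in> trunc_ideal F v \<pi> 1" "y = d \<oplus> t"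
      by (auto simp: a_r_coset_def')
    have carr: "d \<in> carrier F" "t \<in> carrier F" "s \<in> carrier F" "\<pi> [^] n \<in> carrier F"
      using d t Q S se unif_carrier by (auto simp: trunc_ideal_eq)
    have "x = (s \<oplus> \<pi> [^] n \<otimes> t) \<oplus> \<pi> [^] n \<otimes> d"
      using carr by (simp add: se(3) y(2) d(2) r_distr a_ac)
    moreover have "val_ge F v (int n + 1) (\<pi> [^] n \<otimes> d)"
      using carr d v_unif_pow[of n] by (intro val_ge_mult) (auto simp: trunc_ideal_eq val_ge_def)
    ultimately show ?thesis
      using se t carr by (intro bexI[of _ "s \<oplus> \<pi> [^] n \<otimes> t"] bexI[of _ "\<pi> [^] n \<otimes> d"])
        (auto simp: trunc_ideal_eq add.commute)
  qed
  moreover have "?S \<subseteq> carrier \<O>"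
    using S(1) Q(1) unif_pow_val_ring[of n] O.a_closed O.m_closed by (auto 0 4 simp del: val_ring_simps simp: val_ring_simps(2,3)[symmetric])
  ultimately show ?case
    using S(2) Q(2) by (intro exI[of _ ?S]) auto
qed

lemma finite_trunc_ring: "finite (carrier (trunc_ring F v \<pi> n))"
proof -
  interpret h: ring_hom_cring \<O> "trunc_ring F v \<pi> n" "(+>\<^bsub>\<O>\<^esub>) (trunc_ideal F v \<pi> n)"
    by (rule trunc_hom)
  let ?h = "(+>\<^bsub>\<O>\<^esub>) (trunc_ideal F v \<pi> n)"
  obtain S where S: "S \<subseteq> carrier \<O>" "finite S"
    "\<And>x. x \<in> carrier \<O> \<Longrightarrow> \<exists>s\<in>S. \<exists>e\<in>trunc_ideal F v \<pi> n. x = s \<oplus> e"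
    using finite_representatives[of n] by blast
  have "?h x \<in> ?h ` S" if "x \<in> carrier \<O>" for x
  proof -
    obtain s e where se: "s \<in> S" "e \<in> trunc_ideal F v \<pi> n" "x = s \<oplus> e"
      using S(3) \<open>x \<in> carrier \<O>\<close> by blast
    have sc: "s \<in> carrier \<O>" and ec: "e \<in> carrier \<O>"
      using se S(1) ideal.Icarr[OF trunc_ideal_ideal] by blast+
    have "?h x = ?h s \<oplus>\<^bsub>trunc_ring F v \<pi> n\<^esub> ?h e"
      using h.hom_add[OF sc ec] se(3) by simp
    also have "?h e = \<zero>\<^bsub>trunc_ring F v \<pi> n\<^esub>"
      using se(2) trunc_kernel by (simp add: trunc_ideal_eq)
    finally show ?thesis using se(1) h.hom_closed[OF sc] by simp
  qed
  hence "carrier (trunc_ring F v \<pi> n) \<subseteq> ?h ` S"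
    unfolding trunc_carrier by blast
  thus ?thesis using S(2) finite_surj by blast
qed

text \<open>If \<open>2\<close> had positive valuation, the order of \<open>1\<close> in the additive group of the residue field
  would divide \<open>2\<close>, and it is not \<open>1\<close> since the residue field is nontrivial.\<close>

lemma two_val_zero:
  assumes "ring_char (residue_field F v) \<noteq> 2"
  shows "\<one> \<oplus> \<one> \<in> carrier F - {\<zero>}" "v (\<one> \<oplus> \<one>) = 0"
proof -
  let ?k = "trunc_ring F v \<pi> 1"
  interpret h: ring_hom_cring \<O> ?k "(+>\<^bsub>\<O>\<^esub>) (trunc_ideal F v \<pi> 1)"
    by (rule trunc_hom)
  have nz: "\<one>\<^bsub>?k\<^esub> \<noteq> \<zero>\<^bsub>?k\<^esub>"
    using trunc_zero_imp_val_ge[of \<one> 1] O.one_closed h.hom_one v_one by (auto simp: val_ge_def)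
  have "\<not> val_ge F v 1 (\<one> \<oplus> \<one>)"
  proof
    assume "val_ge F v 1 (\<one> \<oplus> \<one>)"
    hence "\<one>\<^bsub>?k\<^esub> \<oplus>\<^bsub>?k\<^esub> \<one>\<^bsub>?k\<^esub> = \<zero>\<^bsub>?k\<^esub>"
      using trunc_kernel[of "\<one> \<oplus> \<one>" 1] h.hom_add[of \<one> \<one>] O.one_closed h.hom_one by simp
    hence "\<one>\<^bsub>?k\<^esub> [^]\<^bsub>add_monoid ?k\<^esub> (2::nat) = \<one>\<^bsub>add_monoid ?k\<^esub>"
      by (simp add: numeral_2_eq_2 del: One_nat_def)
    hence "group.ord (add_monoid ?k) \<one>\<^bsub>?k\<^esub> dvd 2"
      using group.pow_eq_id[OF h.S.a_group, of "\<one>\<^bsub>?k\<^esub>" 2] by (simp del: One_nat_def)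
    moreover have "group.ord (add_monoid ?k) \<one>\<^bsub>?k\<^esub> \<noteq> 1"
      using group.ord_eq_1[OF h.S.a_group, of "\<one>\<^bsub>?k\<^esub>"] nz by (simp del: One_nat_def)
    ultimately have "ring_char ?k = 2"
      using prime_nat_iff two_is_prime_nat unfolding ring_char_def by blast
    thus False using assms by (simp add: residue_field_eq)
  qed
  moreover have "val_ge F v 0 (\<one> \<oplus> \<one>)"
    using O.a_closed[OF O.one_closed O.one_closed] by simp
  ultimately show "\<one> \<oplus> \<one> \<in> carrier F - {\<zero>}" "v (\<one> \<oplus> \<one>) = 0"
    by (auto simp: val_ge_def)
qed

lemma trunc_unit:
  assumes "x \<in> carrier F - {\<zero>}" "v x = 0"
  shows "trunc_ideal F v \<pi> n +>\<^bsub>\<O>\<^esub> x \<in> Units (trunc_ring F v \<pi> n)"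
proof -
  interpret h: ring_hom_cring \<O> "trunc_ring F v \<pi> n" "(+>\<^bsub>\<O>\<^esub>) (trunc_ideal F v \<pi> n)"
    by (rule trunc_hom)
  note i = v_inv[OF assms(1)]
  have carr: "x \<in> carrier \<O>" "inv x \<in> carrier \<O>"
    using assms i by (auto simp: val_ge_def)
  show ?thesis
    using h.hom_mult[OF carr] h.hom_mult[OF carr(2,1)] h.hom_closed[OF carr(1)] h.hom_closed[OF carr(2)] i(2,3) h.hom_one
    unfolding Units_def by auto
qed

lemma trunc_ring_truncated:
  assumes "ring_char (residue_field F v) \<noteq> 2"
  shows "truncated_valuation_ring (trunc_ring F v \<pi> r) (trunc_unif F v \<pi> r) r"
proof -
  let ?R = "trunc_ring F v \<pi> r"
  interpret h: ring_hom_cring \<O> ?R "(+>\<^bsub>\<O>\<^esub>) (trunc_ideal F v \<pi> r)"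
    by (rule trunc_hom)
  let ?h = "(+>\<^bsub>\<O>\<^esub>) (trunc_ideal F v \<pi> r)"
  have \<pi>: "\<pi> \<in> carrier \<O>" using unif_carrier by (simp add: val_ge_def)
  show ?thesis
    unfolding truncated_valuation_ring_def truncated_valuation_ring_axioms_def
  proof (intro conjI allI impI)
    show "cring ?R" by (rule h.S.is_cring)
    show "finite (carrier ?R)" by (rule finite_trunc_ring)
    show "trunc_unif F v \<pi> r \<in> carrier ?R"
      unfolding trunc_unif_def by (rule h.hom_closed[OF \<pi>])
    have "trunc_unif F v \<pi> r [^]\<^bsub>?R\<^esub> r = ?h (\<pi> [^] r)"
      unfolding trunc_unif_def using
      ring_hom_ring.hom_nat_pow[OF ideal.rcos_ring_hom_ring[OF trunc_ideal_ideal] \<pi>, of r r]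
      by (simp add: trunc_ring_def)
    also have "\<dots> = \<zero>\<^bsub>?R\<^esub>"
      using v_unif_pow[of r] by (intro trunc_kernel) (auto simp: val_ge_def)
    finally show "trunc_unif F v \<pi> r [^]\<^bsub>?R\<^esub> r = \<zero>\<^bsub>?R\<^esub>" .
    have "?h (\<one> \<oplus> \<one>) = \<one>\<^bsub>?R\<^esub> \<oplus>\<^bsub>?R\<^esub> \<one>\<^bsub>?R\<^esub>"
      using h.hom_add[OF O.one_closed O.one_closed] h.hom_one by simp
    thus "\<one>\<^bsub>?R\<^esub> \<oplus>\<^bsub>?R\<^esub> \<one>\<^bsub>?R\<^esub> \<in> Units ?R"
      using trunc_unit[OF two_val_zero[OF assms]] by metis
    fix z assume "z \<in> carrier ?R"
    then obtain x where x: "x \<in> carrier \<O>" and z: "z = ?h x"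
      by (auto simp: trunc_carrier)
    show "z \<in> Units ?R \<or> (\<exists>y\<in>carrier ?R. z = trunc_unif F v \<pi> r \<otimes>\<^bsub>?R\<^esub> y)"
    proof (cases "val_ge F v 1 x")
      case False
      hence "x \<in> carrier F - {\<zero>}" "v x = 0"
        using x by (auto simp: val_ge_def)
      thus ?thesis using trunc_unit z by blast
    next
      case True
      then obtain y where y: "y \<in> carrier \<O>" "x = \<pi> \<otimes> y"
        using val_ge_iff_multiple[of x 1] x unif_carrier by auto
      thus ?thesis
        using h.hom_mult[OF \<pi> y(1)] h.hom_closed[OF y(1)] z by (auto simp: trunc_unif_def)
    qed
  qed
qed

end
end

section \<open>Vanishing of the character\<close>

theorem proposition8:
  fixes F :: "('a, 'm) ring_scheme" and v :: "'a \<Rightarrow> int" and \<pi> :: 'a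
    and R :: "'a set ring" and w \<epsilon> \<alpha> \<beta> :: "'a set" and r i :: nat
    and \<mu> \<mu>' :: "'a set \<Rightarrow> complex"
  assumes "nonarch_local_field F v"
    and "ring_char (residue_field F v) \<noteq> 2"
    and "uniformizer F v \<pi>"
    and "2 \<le> r" and "even r"
    and "R = trunc_ring F v \<pi> r"
    and "w = trunc_unif F v \<pi> r"
    and "\<epsilon> \<in> Units R" and "\<not> (\<exists>x\<in>carrier R. \<epsilon> = x \<otimes>\<^bsub>R\<^esub> x)"
    and "regular_couple R w r \<mu> \<mu>'"
    and "i \<le> r - 1"
    and "\<alpha> \<in> carrier R" and "\<beta> \<in> Units R"
    and "\<alpha> [^]\<^bsub>R\<^esub> (2::nat) \<ominus>\<^bsub>R\<^esub> \<epsilon> \<otimes>\<^bsub>R\<^esub> \<beta> [^]\<^bsub>R\<^esub> (2::nat) \<otimes>\<^bsub>R\<^esub> w [^]\<^bsub>R\<^esub> (2 * i) \<in> Units R"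
  shows "principal_split_character R w r \<mu> \<mu>' (C_matrix R w \<epsilon> i \<alpha> \<beta>) = 0"
proof -
  have "truncated_valuation_ring R w r"
    using nonarch_local_field.trunc_ring_truncated[OF assms(1,3,2)] by (simp add: assms(6,7))
  moreover have "r = 2 * (r div 2)" "0 < r div 2"
    using assms(4,5) by auto
  ultimately show ?thesis
    by (rule truncated_valuation_ring.principal_split_character_C_matrix[OF _ _ _ assms(8-14)])
qed

end
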